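(* Assume that $\mathbb{P}(I(\boldsymbol\Theta)\in\mathbb{Z})=1$. Then $\mathbb{P}(I(\boldsymbol\Theta)=0)>0$ and for all non negative measurable functions $H$ on $(\mathbb{R}^d)^{\mathbb{Z}}$, $$\nu(H)=\sum_{j\in\mathbb{Z}}\int_0^\infty \mathbb{E}\left[H(rB^j\boldsymbol\Theta)\mathbf{1}\{I(\boldsymbol\Theta)=0\}\right]\alpha r^{-\alpha-1}\,\mathrm{d}r .$$ If moreover $\sum_{j\in\mathbb{Z}}\nu(\{\boldsymbol y:|\boldsymbol y_j|=0\})=0$, or equivalently $\sum_{j\in\mathbb{Z}}\mathbb{P}(|\boldsymbol\Theta_j|=0)=0$, then for all non negative measurable functions $H$ on $(\mathbb{R}^d)^{\mathbb{Z}}$, $$\nu(H)=\int_0^\infty\mathbb{E}[H(r\boldsymbol\Theta)]\,\alpha r^{-\alpha-1}\,\mathrm{d}r .$$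
   Context: Let $|\cdot|$ be an arbitrary norm on $\mathbb{R}^d$. Let $\{\boldsymbol X_j,j\in\mathbb{Z}\}$ be a stationary $\mathbb{R}^d$-valued time series which is regularly varying: for all integers $s\le t$ there is a non-zero Radon measure $\nu_{s,t}$ on $(\mathbb{R}^d)^{[s,t]}\setminus\{\boldsymbol 0\}$ such that $\mathbb{P}(u^{-1}(\boldsymbol X_s,\dots,\boldsymbol X_t)\in\cdot)/\mathbb{P}(|\boldsymbol X_0|>u)\to\nu_{s,t}$ vaguely as $u\to\infty$. Let $\alpha>0$ be its tail index. The tail process is the random sequence $\boldsymbol Y=\{\boldsymbol Y_j,j\in\mathbb{Z}\}$ with $\mathbb{P}(|\boldsymbol Y_0|>y)=y^{-\alpha}$ for $y\ge1$ and such that, for all $s\le t$, the law of $u^{-1}(\boldsymbol X_s,\dots,\boldsymbol X_t)$ conditionally on $|\boldsymbol X_0|>u$ converges weakly to that of $(\boldsymbol Y_s,\dots,\boldsymbol Y_t)$ as $u\to\infty$. The spectral tail process is $\boldsymbol\Theta_j=\boldsymbol Y_j/|\boldsymbol Y_0|$, $j\in\mathbb{Z}$; it is independent of $|\boldsymbol Y_0|$. The tail measure $\nu$ is the unique Borel measure on $(\mathbb{R}^d)^{\mathbb{Z}}$ (product topology) with $\nu(\{\boldsymbol 0\})=0$ and $\nu\circ p_{s,t}^{-1}=\nu_{s,t}$ on $(\mathbb{R}^d)^{[s,t]}\setminus\{\boldsymbol 0\}$ for all $s\le t$, where $p_{s,t}$ is the canonical projection. It is known that $\nu$ is $\sigma$-finite,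 shift invariant, satisfies $\nu(c\,\cdot)=c^{-\alpha}\nu$ for all $c>0$, and $\mathbb{E}[H(\boldsymbol Y)]=\int H(\boldsymbol y)\mathbf{1}\{|\boldsymbol y_0|>1\}\,\nu(\mathrm{d}\boldsymbol y)$ for every non negative measurable $H$. Notation: $\nu(H)=\int H\,\mathrm{d}\nu$. $B$ is the backshift, $(B\boldsymbol x)_j=\boldsymbol x_{j-1}$, and $B^k$, $k\in\mathbb{Z}$, its iterates. For $-\infty\le s\le t\le\infty$, $\boldsymbol y^*_{s,t}=\max_{s\le i\le t}|\boldsymbol y_i|$ and $\boldsymbol y^*=\max_{i\in\mathbb{Z}}|\boldsymbol y_i|$ (understood as suprema in $[0,\infty]$). The infargmax functional $I$ on $(\mathbb{R}^d)^{\mathbb{Z}}$ is: $I(\boldsymbol y)=j\in\mathbb{Z}$ if $\boldsymbol y^*_{-\infty,j-1}<|\boldsymbol y_j|$ and $\boldsymbol y^*_{j+1,\infty}\le|\boldsymbol y_j|$; $I(\boldsymbol y)=-\infty$ if $\boldsymbol y^*=\boldsymbol y^*_{-\infty,j}$ for all $j\in\mathbb{Z}$; $I(\boldsymbol y)=+\infty$ if $\boldsymbol y^*>\boldsymbol y^*_{-\infty,j}$ for all $j\in\mathbb{Z}$. *)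

theory Defs
  imports "HOL-Probability.Probability" "HOL-Library.Extended"
begin

(* The infinity symbols of Extended clash with those of Extended_Nat and Extended_Real. *)
no_notation Pinf ("\<infinity>") and Minf ("-\<infinity>")

section \<open>Norms and sequences\<close>

(* The norm is arbitrary, hence a function N and not the Euclidean norm of the type class.
   All norms on real ^ 'd induce the topology and the Borel sets of the type class. *)
definition is_norm :: "(real ^ 'd \<Rightarrow> real) \<Rightarrow> bool" where
  "is_norm N \<longleftrightarrow>
     (\<forall>x. 0 \<le> N x) \<and> (\<forall>x. N x = 0 \<longleftrightarrow> x = 0) \<and>
     (\<forall>a x. N (a *\<^sub>R x) = \<bar>a\<bar> * N x) \<and> (\<forall>x y. N (x + y) \<le> N x + N y)"

(* backshift k is the k-th iterate of the backshift, for every integer k. *)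
definition backshift :: "int \<Rightarrow> (int \<Rightarrow> 'a) \<Rightarrow> int \<Rightarrow> 'a" where
  "backshift k x = (\<lambda>j. x (j - k))"

lemma backshift_0: "backshift 0 x = x"
  by (simp add: backshift_def)

lemma backshift_add: "backshift (k + l) x = backshift k (backshift l x)"
  by (simp add: backshift_def algebra_simps)

definition max_norm :: "(real ^ 'd \<Rightarrow> real) \<Rightarrow> int set \<Rightarrow> (int \<Rightarrow> real ^ 'd) \<Rightarrow> ennreal" where
  "max_norm N A y = (SUP i\<in>A. ennreal (N (y i)))"

definition is_infargmax :: "(real ^ 'd \<Rightarrow> real) \<Rightarrow> (int \<Rightarrow> real ^ 'd) \<Rightarrow> int \<Rightarrow> bool" where
  "is_infargmax N y j \<longleftrightarrow>
     max_norm N {..j - 1} y < ennreal (N (y j)) \<and> max_norm N {j + 1..} y \<le> ennreal (N (y j))"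

(* The lemmas infargmax_eq_Fin_iff, infargmax_eq_Minf_iff and infargmax_eq_Pinf_iff below show
   that the three cases are exhaustive and mutually exclusive. *)
definition infargmax :: "(real ^ 'd \<Rightarrow> real) \<Rightarrow> (int \<Rightarrow> real ^ 'd) \<Rightarrow> int extended" where
  "infargmax N y =
     (if \<exists>j. is_infargmax N y j then Fin (THE j. is_infargmax N y j)
      else if \<forall>j. max_norm N UNIV y = max_norm N {..j} y then Minf
      else Pinf)"

lemma is_infargmax_unique:
  assumes "is_infargmax N y j" "is_infargmax N y k"
  shows "j = k"
proof -
  have aux: "\<not> (is_infargmax N y j \<and> is_infargmax N y k)" if "j < k" for j k
  proof
    assume a: "is_infargmax N y j \<and> is_infargmax N y k"
    have "ennreal (N (y k)) \<le> max_norm N {j + 1..} y"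
      unfolding max_norm_def using that by (intro SUP_upper) auto
    also have "\<dots> \<le> ennreal (N (y j))" using a by (simp add: is_infargmax_def)
    also have "\<dots> \<le> max_norm N {..k - 1} y"
      unfolding max_norm_def using that by (intro SUP_upper) auto
    also have "\<dots> < ennreal (N (y k))" using a by (simp add: is_infargmax_def)
    finally show False by simp
  qed
  show ?thesis using aux[of j k] aux[of k j] assms by (cases j k rule: linorder_cases) auto
qed

lemma infargmax_eq_Fin_iff: "infargmax N y = Fin j \<longleftrightarrow> is_infargmax N y j"
proof
  assume a: "is_infargmax N y j"
  then have "(THE k. is_infargmax N y k) = j"
    using is_infargmax_unique by blast
  then show "infargmax N y = Fin j" using a by (auto simp: infargmax_def)
next
  assume "infargmax N y = Fin j"
  then obtain k where "is_infargmax N y k" "(THE k. is_infargmax N y k) = j"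
    by (auto simp: infargmax_def split: if_splits)
  then show "is_infargmax N y j" using is_infargmax_unique by (metis the_equality)
qed

lemma max_norm_mono: "A \<subseteq> B \<Longrightarrow> max_norm N A y \<le> max_norm N B y"
  unfolding max_norm_def by (intro SUP_subset_mono) auto

lemma is_infargmax_max_norm:
  assumes "is_infargmax N y j"
  shows "max_norm N {..j - 1} y < max_norm N UNIV y" "max_norm N {..j} y = max_norm N UNIV y"
proof -
  have le: "ennreal (N (y j)) \<le> max_norm N {..j} y"
    unfolding max_norm_def by (intro SUP_upper) auto
  show "max_norm N {..j - 1} y < max_norm N UNIV y"
    using assms le max_norm_mono[of "{..j}" UNIV N y]
    unfolding is_infargmax_def by (meson less_le_trans subset_UNIV)
  have "ennreal (N (y i)) \<le> ennreal (N (y j))" for i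
  proof (cases i j rule: linorder_cases)
    case less
    then have "ennreal (N (y i)) \<le> max_norm N {..j - 1} y"
      unfolding max_norm_def by (intro SUP_upper) auto
    then show ?thesis using assms unfolding is_infargmax_def by (meson less_imp_le order_trans)
  next
    case greater
    then have "ennreal (N (y i)) \<le> max_norm N {j + 1..} y"
      unfolding max_norm_def by (intro SUP_upper) auto
    then show ?thesis using assms unfolding is_infargmax_def by (meson less_imp_le order_trans)
  qed simp
  then have "max_norm N UNIV y \<le> ennreal (N (y j))"
    unfolding max_norm_def by (intro SUP_least)
  then show "max_norm N {..j} y = max_norm N UNIV y"
    using le max_norm_mono[of "{..j}" UNIV N y] by auto
qed

lemma infargmax_eq_Minf_iff:
  "infargmax N y = Minf \<longleftrightarrow> (\<forall>j. max_norm N UNIV y = max_norm N {..j} y)"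
proof
  assume "infargmax N y = Minf"
  then show "\<forall>j. max_norm N UNIV y = max_norm N {..j} y"
    unfolding infargmax_def by (metis extended.distinct)
next
  assume a: "\<forall>j. max_norm N UNIV y = max_norm N {..j} y"
  have "\<not> is_infargmax N y j" for j
    using is_infargmax_max_norm(1)[of N y j] a[rule_format, of "j - 1"] by auto
  then show "infargmax N y = Minf" using a by (simp add: infargmax_def)
qed

lemma infargmax_eq_Pinf_iff:
  "infargmax N y = Pinf \<longleftrightarrow> (\<forall>j. max_norm N UNIV y > max_norm N {..j} y)"
proof
  assume a: "\<forall>j. max_norm N UNIV y > max_norm N {..j} y"
  have "\<not> is_infargmax N y j" for j
    using is_infargmax_max_norm(2)[of N y j] a[rule_format, of j] by auto
  moreover have "\<not> (\<forall>j. max_norm N UNIV y = max_norm N {..j} y)"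
    using a[rule_format, of 0] by (metis less_irrefl)
  ultimately show "infargmax N y = Pinf" unfolding infargmax_def by simp
next
  assume P: "infargmax N y = Pinf"
  then have no: "\<not> is_infargmax N y i" for i
    using infargmax_eq_Fin_iff[of N y i] by simp
  obtain k where "max_norm N UNIV y \<noteq> max_norm N {..k} y"
    using P infargmax_eq_Minf_iff[of N y] by auto
  then have k: "max_norm N {..k} y < max_norm N UNIV y"
    using max_norm_mono[of "{..k}" UNIV N y] by (simp add: order_less_le)
  have step: "max_norm N {..k + int n} y < max_norm N UNIV y" for n
  proof (induction n)
    case 0
    show ?case using k by simp
  next
    case (Suc n)
    let ?j = "k + int (Suc n)"
    have [simp]: "?j - 1 = k + int n" by simp
    have "max_norm N {?j + 1..} y \<le> max_norm N UNIV y" by (rule max_norm_mono) simp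
    then have "ennreal (N (y ?j)) \<noteq> max_norm N UNIV y"
      using no[of ?j] Suc unfolding is_infargmax_def by auto
    moreover have "ennreal (N (y ?j)) \<le> max_norm N UNIV y"
      unfolding max_norm_def by (intro SUP_upper) auto
    moreover have "{..?j} = insert ?j {..k + int n}" by auto
    ultimately show ?case using Suc by (auto simp: max_norm_def sup_max less_le max_def)
  qed
  show "\<forall>j. max_norm N UNIV y > max_norm N {..j} y"
  proof
    fix j
    have "max_norm N {..j} y \<le> max_norm N {..k + int (nat (j - k))} y"
      by (rule max_norm_mono) auto
    then show "max_norm N UNIV y > max_norm N {..j} y" using step[of "nat (j - k)"] by simp
  qed
qed

section \<open>Convergence of measures\<close>

definition borel_on :: "'a topology \<Rightarrow> 'a measure" where
  "borel_on T = sigma (topspace T) {U. openin T U}"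

definition radon_measure_on :: "'a topology \<Rightarrow> 'a measure \<Rightarrow> bool" where
  "radon_measure_on T \<mu> \<longleftrightarrow>
     space \<mu> = topspace T \<and> sets \<mu> = sets (borel_on T) \<and>
     (\<forall>K. compactin T K \<longrightarrow> K \<in> sets \<mu> \<longrightarrow> emeasure \<mu> K < top) \<and>
     (\<forall>A\<in>sets \<mu>. emeasure \<mu> A = (SUP K\<in>{K \<in> sets \<mu>. compactin T K \<and> K \<subseteq> A}. emeasure \<mu> K))"

definition vaguely_converges ::
    "'a topology \<Rightarrow> (real \<Rightarrow> 'a measure) \<Rightarrow> 'a measure \<Rightarrow> bool" where
  "vaguely_converges T \<mu> \<nu> \<longleftrightarrow>
     (\<forall>f. continuous_map T euclideanreal f \<and>
          (\<exists>K. compactin T K \<and> (\<forall>x\<in>topspace T - K. f x = 0)) \<longrightarrow>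
          ((\<lambda>u. \<integral>x. f x \<partial>\<mu> u) \<longlongrightarrow> (\<integral>x. f x \<partial>\<nu>)) at_top)"

definition weakly_converges ::
    "'a topology \<Rightarrow> (real \<Rightarrow> 'a measure) \<Rightarrow> 'a measure \<Rightarrow> bool" where
  "weakly_converges T \<mu> \<nu> \<longleftrightarrow>
     (\<forall>f. continuous_map T euclideanreal f \<and> bounded (f ` topspace T) \<longrightarrow>
          ((\<lambda>u. \<integral>x. f x \<partial>\<mu> u) \<longlongrightarrow> (\<integral>x. f x \<partial>\<nu>)) at_top)"

section \<open>Regularly varying time series\<close>

(* The product of copies of R^d indexed by the window from s to t, as extensional functions
   on {s..t}; restrict y {s..t} is the canonical projection of y. *)
definition window_top :: "int \<Rightarrow> int \<Rightarrow> (int \<Rightarrow> real ^ 'd) topology" where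
  "window_top s t = product_topology (\<lambda>_. euclidean) {s..t}"

definition punctured_window_top :: "int \<Rightarrow> int \<Rightarrow> (int \<Rightarrow> real ^ 'd) topology" where
  "punctured_window_top s t =
     subtopology (window_top s t) (topspace (window_top s t) - {\<lambda>j\<in>{s..t}. 0})"

definition scaled_window ::
    "(int \<Rightarrow> 'w \<Rightarrow> real ^ 'd) \<Rightarrow> int \<Rightarrow> int \<Rightarrow> real \<Rightarrow> 'w \<Rightarrow> int \<Rightarrow> real ^ 'd" where
  "scaled_window X s t u \<omega> = (\<lambda>j\<in>{s..t}. (1 / u) *\<^sub>R X j \<omega>)"

definition stationary :: "'w measure \<Rightarrow> (int \<Rightarrow> 'w \<Rightarrow> real ^ 'd) \<Rightarrow> bool" where
  "stationary M X \<longleftrightarrow>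
     (\<forall>h. distr M borel (\<lambda>\<omega> j. X (j + h) \<omega>) = distr M borel (\<lambda>\<omega> j. X j \<omega>))"

(* Radon measures and vague convergence are those of the locally compact punctured window: compact
   sets stay away from 0 and are bounded. Under has_tail_index below and stationarity no mass
   escapes to infinity, so bounded continuous test functions with support bounded away from 0 give the same notion.
   The division is by 0 for those u with P(N(X_0) > u) = 0. If there are arbitrarily large such u,
   the limit measures vanish, which the third conjunct excludes. *)
definition regularly_varying ::
    "(real ^ 'd \<Rightarrow> real) \<Rightarrow> 'w measure \<Rightarrow> (int \<Rightarrow> 'w \<Rightarrow> real ^ 'd) \<Rightarrow>
     (int \<Rightarrow> int \<Rightarrow> (int \<Rightarrow> real ^ 'd) measure) \<Rightarrow> bool" where
  "regularly_varying N M X \<nu>w \<longleftrightarrow>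
     (\<forall>s t. s \<le> t \<longrightarrow>
        radon_measure_on (punctured_window_top s t) (\<nu>w s t) \<and>
        emeasure (\<nu>w s t) (space (\<nu>w s t)) \<noteq> 0 \<and>
        vaguely_converges (punctured_window_top s t)
          (\<lambda>u. scale_measure (ennreal (1 / \<P>(\<omega> in M. N (X 0 \<omega>) > u)))
                 (restrict_space (distr M (borel_on (window_top s t)) (scaled_window X s t u))
                    (topspace (punctured_window_top s t))))
          (\<nu>w s t))"

definition has_tail_index ::
    "(real ^ 'd \<Rightarrow> real) \<Rightarrow> 'w measure \<Rightarrow> (int \<Rightarrow> 'w \<Rightarrow> real ^ 'd) \<Rightarrow> real \<Rightarrow> bool" where
  "has_tail_index N M X \<alpha> \<longleftrightarrow>
     \<alpha> > 0 \<and>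
     (\<forall>c>0. ((\<lambda>u. \<P>(\<omega> in M. N (X 0 \<omega>) > c * u) / \<P>(\<omega> in M. N (X 0 \<omega>) > u))
        \<longlongrightarrow> c powr (- \<alpha>)) at_top)"

(* The tail process Y may live on a probability space P of its own. *)
definition is_tail_process ::
    "(real ^ 'd \<Rightarrow> real) \<Rightarrow> 'w measure \<Rightarrow> (int \<Rightarrow> 'w \<Rightarrow> real ^ 'd) \<Rightarrow> real \<Rightarrow>
     'v measure \<Rightarrow> (int \<Rightarrow> 'v \<Rightarrow> real ^ 'd) \<Rightarrow> bool" where
  "is_tail_process N M X \<alpha> P Y \<longleftrightarrow>
     (\<forall>y\<ge>1. \<P>(\<omega> in P. N (Y 0 \<omega>) > y) = y powr (- \<alpha>)) \<and>
     (\<forall>s t. s \<le> t \<longrightarrow>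
        weakly_converges (window_top s t)
          (\<lambda>u. distr (uniform_measure M {\<omega> \<in> space M. N (X 0 \<omega>) > u})
                 (borel_on (window_top s t)) (scaled_window X s t u))
          (distr P (borel_on (window_top s t)) (\<lambda>\<omega>. \<lambda>j\<in>{s..t}. Y j \<omega>)))"

definition spectral_tail_process ::
    "(real ^ 'd \<Rightarrow> real) \<Rightarrow> (int \<Rightarrow> 'v \<Rightarrow> real ^ 'd) \<Rightarrow> 'v \<Rightarrow> int \<Rightarrow> real ^ 'd" where
  "spectral_tail_process N Y \<omega> = (\<lambda>j. (1 / N (Y 0 \<omega>)) *\<^sub>R Y j \<omega>)"

(* borel on the type int => real ^ 'd is the Borel sigma-algebra of the product topology. *)
definition is_tail_measure ::
    "(int \<Rightarrow> int \<Rightarrow> (int \<Rightarrow> real ^ 'd) measure) \<Rightarrow> (int \<Rightarrow> real ^ 'd) measure \<Rightarrow> bool" where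
  "is_tail_measure \<nu>w \<nu> \<longleftrightarrow>
     sets \<nu> = sets borel \<and> emeasure \<nu> {\<lambda>_. 0} = 0 \<and>
     (\<forall>s t. s \<le> t \<longrightarrow>
        (\<forall>A\<in>sets (borel_on (punctured_window_top s t)).
           emeasure \<nu> {y. restrict y {s..t} \<in> A} = emeasure (\<nu>w s t) A))"

end

theory Submission
  imports Defs
begin

text \<open>
  The proof rests on one identity, valid for every integer \<open>j\<close>, every \<open>\<delta> > 0\<close> and every
  non-negative measurable \<open>H\<close>: the integral of \<open>H\<close> over \<open>{N (y j) > \<delta>}\<close> with respect to \<open>\<nu>\<close> is
  \<open>\<delta> powr (- \<alpha>)\<close> times the expectation of \<open>H (\<delta> B^j Y)\<close> (lemma \<open>tail_measure_exceedance\<close>). It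
  combines shift invariance and homogeneity of \<open>\<nu>\<close> with the relation between \<open>\<nu>\<close> and the tail
  process. For continuous compactly supported test functions that vanish on \<open>{N (y j) \<le> \<delta>}\<close>, the
  two sides are limits of the same normalised expectations of the time series, once through the
  vague convergence that defines \<open>\<nu>\<close> and once through the weak convergence that defines \<open>Y\<close>;
  stationarity and the tail index connect the two. Monotone limits and uniqueness of measures
  extend the identity to all \<open>H\<close>.

  Applied to the event that \<open>y / N (y j)\<close> lies in a given set, the identity shows that under \<open>\<nu>\<close>
  the radius \<open>N (y j)\<close> and the direction \<open>y / N (y j)\<close> are independent in the sense of a product
  measure: the radius has density \<open>\<alpha> r powr (- \<alpha> - 1)\<close> and the direction has the law of \<open>B^j \<Theta>\<close>. So
  \<open>\<nu>\<close> restricted to \<open>{N (y j) > 0}\<close> has a polar decomposition for each \<open>j\<close> (lemma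
  \<open>tail_measure_polar\<close>). If \<open>\<nu>\<close> does not charge \<open>{N (y 0) = 0}\<close>, the case \<open>j = 0\<close> is the second
  representation of the theorem.

  For the first representation, the assumption on \<open>\<Theta>\<close> implies that the infargmax is finite
  \<open>\<nu>\<close>-almost everywhere. So \<open>\<nu>\<close> is the sum of its restrictions to the events that the infargmax
  equals \<open>j\<close>. On such an event \<open>N (y j) > 0\<close>, and the polar decomposition at \<open>j\<close> gives the \<open>j\<close>-th
  summand, because the infargmax is invariant under scaling and moves along with the backshift. If
  the infargmax of \<open>\<Theta>\<close> were almost surely non-zero, all summands would vanish, although \<open>\<nu>\<close> gives
  mass 1 to \<open>{N (y 0) > 1}\<close>.
\<close>

section \<open>Norms and the infargmax functional\<close>

text \<open>A norm is convex, and finite convex functions on a finite-dimensional space are continuous;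
  this gives Borel measurability for a norm unrelated to the Euclidean one.\<close>
lemma is_norm_borel:
  fixes N :: "real ^ 'd \<Rightarrow> real"
  assumes "is_norm N"
  shows "continuous_on UNIV N" "N \<in> borel_measurable borel"
proof -
  have "convex_on UNIV N"
  proof (rule convex_onI)
    fix t :: real and x y :: "real ^ 'd" assume "0 < t" "t < 1"
    then show "N ((1 - t) *\<^sub>R x + t *\<^sub>R y) \<le> (1 - t) * N x + t * N y"
      using assms unfolding is_norm_def by (smt (verit))
  qed simp
  then show "continuous_on UNIV N"
    by (rule convex_on_continuous[OF open_UNIV])
  then show "N \<in> borel_measurable borel"
    by (rule borel_measurable_continuous_onI)
qed

lemma is_norm_scale: "is_norm N \<Longrightarrow> c \<ge> 0 \<Longrightarrow> N (c *\<^sub>R x) = c * N x"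
  by (simp add: is_norm_def)

lemma measurable_coordinate [measurable]:
  "(\<lambda>y :: int \<Rightarrow> real ^ 'd. y j) \<in> borel_measurable borel"
  by (intro borel_measurable_continuous_onI continuous_on_product_coordinates)

lemma measurable_sequence:
  fixes f :: "'a \<Rightarrow> int \<Rightarrow> real ^ 'd"
  assumes "\<And>j. (\<lambda>x. f x j) \<in> borel_measurable M"
  shows "f \<in> borel_measurable M"
  using assms by (rule measurable_coordinatewise_then_product)

lemma measurable_infargmax_eq:
  fixes N :: "real ^ 'd \<Rightarrow> real"
  assumes [measurable]: "N \<in> borel_measurable borel"
  shows "{y. infargmax N y = Fin j} \<in> sets borel"
proof -
  have [measurable]: "max_norm N A \<in> borel_measurable borel" for A
    unfolding max_norm_def[abs_def]
    by (rule borel_measurable_SUP) (auto intro: countable_subset[of _ UNIV])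
  have "{y \<in> space borel. is_infargmax N y j} \<in> sets borel"
    unfolding is_infargmax_def not_less[symmetric, of "max_norm _ _ _"] by measurable
  then show ?thesis by (simp add: infargmax_eq_Fin_iff)
qed

text \<open>Because of this scale invariance the infargmax sees only the angular part of a sequence: it
  takes the same value at \<open>\<Theta>\<close> and at every positive multiple of \<open>\<Theta>\<close>.\<close>
lemma infargmax_scale:
  assumes "is_norm N" "c > 0"
  shows "infargmax N (\<lambda>i. c *\<^sub>R y i) = Fin j \<longleftrightarrow> infargmax N y = Fin j"
proof -
  have *: "ennreal (N (c *\<^sub>R y i)) = ennreal c * ennreal (N (y i))" for i
    using assms by (simp add: is_norm_scale ennreal_mult')
  have **: "max_norm N A (\<lambda>i. c *\<^sub>R y i) = ennreal c * max_norm N A y" for A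
    unfolding max_norm_def * by (simp add: SUP_mult_left_ennreal)
  have le: "ennreal c * a \<le> ennreal c * b \<longleftrightarrow> a \<le> b" for a b
    using assms by (intro ennreal_mult_le_mult_iff) auto
  show ?thesis
    unfolding infargmax_eq_Fin_iff is_infargmax_def * ** le by (simp add: le flip: not_le)
qed

lemma infargmax_backshift:
  "infargmax N (backshift k y) = Fin j \<longleftrightarrow> infargmax N y = Fin (j - k)"
proof -
  have *: "max_norm N A (backshift k y) = max_norm N ((\<lambda>i. i - k) ` A) y" for A
    by (simp add: max_norm_def backshift_def image_image)
  have "(\<lambda>i. i - k) ` {..j - 1} = {..j - k - 1}" "(\<lambda>i. i - k) ` {j + 1..} = {j - k + 1..}"
    by (auto intro!: image_eqI[where x = "_ + k"])
  then show ?thesis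
    unfolding infargmax_eq_Fin_iff is_infargmax_def * by (simp add: backshift_def)
qed

section \<open>Polar decomposition from one-coordinate exceedances\<close>

lemma nn_integral_power_tail:
  fixes \<alpha> a :: real
  assumes "\<alpha> > 0" "a > 0"
  shows "(\<integral>\<^sup>+r. ennreal (\<alpha> * r powr (- \<alpha> - 1)) * indicator {a<..} r \<partial>lborel) = ennreal (a powr (- \<alpha>))"
proof -
  have "(\<integral>\<^sup>+r. ennreal (\<alpha> * r powr (- \<alpha> - 1)) * indicator {a<..} r \<partial>lborel) =
        (\<integral>\<^sup>+r. ennreal (\<alpha> * r powr (- \<alpha> - 1)) * indicator {a..} r \<partial>lborel)"
    by (intro nn_integral_cong_AE eventually_mono[OF AE_lborel_singleton[of a]])
       (auto split: split_indicator)
  also have "\<dots> = ennreal (0 - (- (a powr (- \<alpha>))))"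
  proof (rule nn_integral_FTC_atLeast)
    fix x assume "a \<le> x"
    then show "((\<lambda>r. - (r powr (- \<alpha>))) has_real_derivative \<alpha> * x powr (- \<alpha> - 1)) (at x)"
      using assms by (auto intro!: derivative_eq_intros)
    show "0 \<le> \<alpha> * x powr (- \<alpha> - 1)" using assms by simp
  next
    have "((\<lambda>r. r powr (- \<alpha>)) \<longlongrightarrow> (0::real)) at_top"
      using assms by (intro tendsto_neg_powr filterlim_ident) auto
    from tendsto_minus[OF this] show "((\<lambda>r. - (r powr (- \<alpha>))) \<longlongrightarrow> (0::real)) at_top" by simp
  qed measurable
  finally show ?thesis by simp
qed

text \<open>All identities below are first obtained on \<open>{g > \<delta>}\<close>, where the measure is finite, and then
  carried to \<open>{g > 0}\<close> by this limit.\<close>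
lemma nn_integral_positive_part_SUP:
  fixes g :: "'a \<Rightarrow> real"
  assumes [measurable]: "h \<in> borel_measurable M" "g \<in> borel_measurable M"
  shows "(\<integral>\<^sup>+x. h x * indicator {x. g x > 0} x \<partial>M) =
         (SUP n. \<integral>\<^sup>+x. h x * indicator {x. g x > 1 / real (Suc n)} x \<partial>M)"
proof -
  have le: "1 / real (Suc n) \<le> 1 / real (Suc m)" if "m \<le> n" for m n
    using that by (simp add: field_simps)
  have *: "(SUP n. h x * indicator {x. g x > 1 / real (Suc n)} x) = h x * indicator {x. g x > 0} x" for x
  proof (cases "g x > 0")
    case True
    then obtain n where n: "1 / real (Suc n) < g x"
      using reals_Archimedean[OF True] by (auto simp: inverse_eq_divide)
    show ?thesis
    proof (rule antisym)
      show "(SUP n. h x * indicator {x. g x > 1 / real (Suc n)} x) \<le> h x * indicator {x. g x > 0} x"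
        using True by (intro SUP_least) (auto split: split_indicator)
      show "h x * indicator {x. g x > 0} x \<le> (SUP n. h x * indicator {x. g x > 1 / real (Suc n)} x)"
        using True n by (intro SUP_upper2[of n]) auto
    qed
  next
    case False
    then have "\<not> g x > 1 / real (Suc n)" for n
      by (smt (verit) of_nat_0_less_iff zero_less_Suc zero_less_divide_1_iff)
    then show ?thesis using False by simp
  qed
  have "(SUP n. \<integral>\<^sup>+x. h x * indicator {x. g x > 1 / real (Suc n)} x \<partial>M) =
        (\<integral>\<^sup>+x. (SUP n. h x * indicator {x. g x > 1 / real (Suc n)} x) \<partial>M)"
  proof (rule nn_integral_monotone_convergence_SUP[symmetric])
    show "incseq (\<lambda>n x. h x * indicator {x. g x > 1 / real (Suc n)} x)"
    proof (intro incseq_SucI le_funI mult_left_mono)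
      fix n x
      show "(indicator {x. g x > 1 / real (Suc n)} x :: ennreal) \<le>
            indicator {x. g x > 1 / real (Suc (Suc n))} x"
        using le[of n "Suc n"] by (auto simp del: of_nat_Suc split: split_indicator)
    qed simp
  qed measurable
  then show ?thesis unfolding * by (rule sym)
qed

lemma emeasure_distr_density:
  assumes [measurable]: "f \<in> borel_measurable M" "g \<in> M \<rightarrow>\<^sub>M K" "A \<in> sets K"
  shows "emeasure (distr (density M f) K g) A = (\<integral>\<^sup>+x. f x * indicator A (g x) \<partial>M)"
  by (subst emeasure_distr)
     (auto simp: emeasure_density intro!: nn_integral_cong split: split_indicator)

text \<open>Suppose that \<open>\<nu>\<close> restricted to \<open>N (y j) > \<delta>\<close> is, up to the factor \<open>\<delta> powr (- \<alpha>)\<close>, the law of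
  \<open>\<delta> Z\<close>, for every \<open>\<delta> > 0\<close>. The direction \<open>y / N (y j)\<close> is insensitive to \<open>\<delta>\<close>, so the mass of
  \<open>{N (y j) > a, y / N (y j) \<in> B}\<close> is \<open>a powr (- \<alpha>)\<close> times the probability that \<open>Z / N (Z j)\<close>
  lies in \<open>B\<close>. Hence radius and direction are independent under \<open>\<nu>\<close>, the radius having density
  \<open>\<alpha> r powr (- \<alpha> - 1)\<close>.\<close>
lemma polar_decomposition:
  fixes N :: "real ^ 'd \<Rightarrow> real" and \<nu> :: "(int \<Rightarrow> real ^ 'd) measure" and Z :: "'v \<Rightarrow> int \<Rightarrow> real ^ 'd"
  assumes N: "is_norm N" and "prob_space P" and \<nu>: "sets \<nu> = sets borel"
    and Z [measurable]: "Z \<in> borel_measurable P" and \<alpha>: "\<alpha> > 0"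
    and exceed: "\<And>\<delta> H. \<delta> > 0 \<Longrightarrow> H \<in> borel_measurable borel \<Longrightarrow>
      (\<integral>\<^sup>+y. H y * indicator {y. N (y j) > \<delta>} y \<partial>\<nu>) =
      ennreal (\<delta> powr (- \<alpha>)) * (\<integral>\<^sup>+\<omega>. H (\<lambda>i. \<delta> *\<^sub>R Z \<omega> i) \<partial>P)"
    and H [measurable]: "H \<in> borel_measurable borel"
  shows "(\<integral>\<^sup>+y. H y * indicator {y. N (y j) > 0} y \<partial>\<nu>) =
    (\<integral>\<^sup>+r\<in>{0<..}. (\<integral>\<^sup>+\<omega>. H (\<lambda>i. r *\<^sub>R (1 / N (Z \<omega> j)) *\<^sub>R Z \<omega> i) \<partial>P) *
       ennreal (\<alpha> * r powr (- \<alpha> - 1)) \<partial>lborel)"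
proof -
  interpret P: prob_space P by fact
  note [measurable] = is_norm_borel(2)[OF N]
  note [measurable_cong] = \<nu>
  define ang where "ang y = (\<lambda>i. (1 / N (y j)) *\<^sub>R y i)" for y :: "int \<Rightarrow> real ^ 'd"
  have [measurable]: "ang \<in> borel_measurable borel"
    unfolding ang_def by (rule measurable_sequence) measurable
  have ang_scale: "ang (\<lambda>i. c *\<^sub>R y i) = ang y" if "c > 0" for c y
    using that by (simp add: ang_def is_norm_scale[OF N])
  have scaleH [measurable]: "(\<lambda>(r, \<theta>). H (\<lambda>i. r *\<^sub>R \<theta> i)) \<in> borel_measurable (borel \<Otimes>\<^sub>M borel)"
  proof -
    have [measurable]: "(\<lambda>x :: real \<times> (int \<Rightarrow> real ^ 'd). snd x i) \<in> borel_measurable (borel \<Otimes>\<^sub>M borel)" for i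
      by (rule measurable_compose[OF measurable_snd measurable_coordinate])
    have "(\<lambda>x :: real \<times> (int \<Rightarrow> real ^ 'd). (\<lambda>i. fst x *\<^sub>R snd x i)) \<in> borel_measurable (borel \<Otimes>\<^sub>M borel)"
      by (intro measurable_sequence borel_measurable_scaleR) measurable
    from measurable_compose[OF this H] show ?thesis by (simp add: case_prod_beta')
  qed
  define L where "L = distr P borel (\<lambda>\<omega>. ang (Z \<omega>))"
  interpret L: prob_space L unfolding L_def by (rule P.prob_space_distr) measurable
  have [measurable_cong]: "sets L = sets borel" by (simp add: L_def)
  define E where "E r = (\<integral>\<^sup>+\<omega>. H (\<lambda>i. r *\<^sub>R ang (Z \<omega>) i) \<partial>P)" for r
  have EL: "E r = (\<integral>\<^sup>+\<theta>. H (\<lambda>i. r *\<^sub>R \<theta> i) \<partial>L)" for r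
  proof -
    have "(\<lambda>\<theta>. H (\<lambda>i. r *\<^sub>R \<theta> i)) \<in> borel_measurable borel"
      using measurable_compose[OF measurable_Pair1'[of r borel borel] scaleH] by simp
    then show ?thesis unfolding E_def L_def by (subst nn_integral_distr) auto
  qed
  have E_meas [measurable]: "E \<in> borel_measurable borel"
    unfolding EL[abs_def] by measurable
  have trunc: "(\<integral>\<^sup>+y. H y * indicator {y. N (y j) > \<delta>} y \<partial>\<nu>) =
      (\<integral>\<^sup>+r. (E r * ennreal (\<alpha> * r powr (- \<alpha> - 1))) * indicator {r. r > \<delta>} r \<partial>lborel)"
    if \<delta>: "\<delta> > 0" for \<delta>
  proof -
    \<comment> \<open>Truncation at \<open>\<delta>\<close> makes both the radial measure \<open>m\<close> and \<open>V\<close> finite, so that product measures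
       and half-lines determine them.\<close>
    define m where "m = density lborel (\<lambda>r. ennreal (\<alpha> * r powr (- \<alpha> - 1)) * indicator {\<delta><..} r)"
    have [measurable_cong]: "sets m = sets borel" by (simp add: m_def)
    have m_tail: "emeasure m {x<..} = ennreal (max x \<delta> powr (- \<alpha>))" for x
    proof -
      have "emeasure m {x<..} =
        (\<integral>\<^sup>+r. ennreal (\<alpha> * r powr (- \<alpha> - 1)) * indicator {max x \<delta><..} r \<partial>lborel)"
        unfolding m_def by (subst emeasure_density) (auto intro!: nn_integral_cong split: split_indicator)
      then show ?thesis using nn_integral_power_tail[OF \<alpha>, of "max x \<delta>"] \<delta> by simp
    qed
    have m_fin: "finite_measure m"
    proof
      have "emeasure m (space m) = emeasure m {\<delta><..}"
        unfolding m_def by (subst (1 2) emeasure_density) (auto intro!: nn_integral_cong split: split_indicator)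
      then show "emeasure m (space m) \<noteq> \<infinity>" by (simp add: m_tail)
    qed
    define V where "V = density \<nu> (indicator {y. N (y j) > \<delta>})"
    define T where "T y = (N (y j), ang y)" for y :: "int \<Rightarrow> real ^ 'd"
    have [measurable]: "T \<in> borel \<rightarrow>\<^sub>M borel \<Otimes>\<^sub>M borel" unfolding T_def by measurable
    have V_sets [measurable_cong]: "sets V = sets borel" by (simp add: V_def \<nu>)
    have prod: "m \<Otimes>\<^sub>M L = distr V (borel \<Otimes>\<^sub>M borel) T"
    proof (rule pair_measure_eqI)
      show "sigma_finite_measure m" using m_fin by (rule finite_measure.axioms)
      show "sigma_finite_measure L" ..
      show "sets (m \<Otimes>\<^sub>M L) = sets (distr V (borel \<Otimes>\<^sub>M borel) T)"
        by (simp add: \<open>sets m = sets borel\<close> \<open>sets L = sets borel\<close> cong: sets_pair_measure_cong)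
    next
      fix A B assume "A \<in> sets m" "B \<in> sets L"
      then have [measurable]: "A \<in> sets borel" "B \<in> sets borel"
        by (simp_all add: \<open>sets m = sets borel\<close> \<open>sets L = sets borel\<close>)
      have "distr (density V (\<lambda>y. indicator B (ang y))) borel (\<lambda>y. N (y j)) = scale_measure (emeasure L B) m"
      proof (rule measure_eqI_lessThan)
        fix x :: real
        let ?a = "max x \<delta>"
        have a: "?a > 0" using \<delta> by simp
        have "emeasure (distr (density V (\<lambda>y. indicator B (ang y))) borel (\<lambda>y. N (y j))) {x<..} =
          (\<integral>\<^sup>+y. indicator B (ang y) * indicator {y. N (y j) > x} y \<partial>V)"
          by (subst emeasure_distr_density) (auto intro!: nn_integral_cong split: split_indicator)
        also have "\<dots> = (\<integral>\<^sup>+y. indicator B (ang y) * indicator {y. N (y j) > ?a} y \<partial>\<nu>)"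
          unfolding V_def by (subst nn_integral_density) (auto intro!: nn_integral_cong split: split_indicator)
        also have "\<dots> = ennreal (?a powr (- \<alpha>)) * (\<integral>\<^sup>+\<omega>. indicator B (ang (\<lambda>i. ?a *\<^sub>R Z \<omega> i)) \<partial>P)"
          by (rule exceed[OF a]) measurable
        also have "(\<integral>\<^sup>+\<omega>. indicator B (ang (\<lambda>i. ?a *\<^sub>R Z \<omega> i)) \<partial>P) = emeasure L B"
          unfolding ang_scale[OF a] L_def
          by (subst emeasure_distr) (auto simp flip: nn_integral_indicator intro!: nn_integral_cong split: split_indicator)
        finally have eq: "emeasure (distr (density V (\<lambda>y. indicator B (ang y))) borel (\<lambda>y. N (y j))) {x<..} =
          ennreal (?a powr (- \<alpha>)) * emeasure L B" .
        then show "emeasure (distr (density V (\<lambda>y. indicator B (ang y))) borel (\<lambda>y. N (y j))) {x<..} =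
          emeasure (scale_measure (emeasure L B) m) {x<..}"
          by (simp add: m_tail mult.commute)
        show "emeasure (distr (density V (\<lambda>y. indicator B (ang y))) borel (\<lambda>y. N (y j))) {x<..} < \<infinity>"
          unfolding eq by (simp add: ennreal_mult_eq_top_iff less_top[symmetric])
      qed (simp_all add: \<open>sets m = sets borel\<close>)
      then have "emeasure (scale_measure (emeasure L B) m) A =
        emeasure (distr (density V (\<lambda>y. indicator B (ang y))) borel (\<lambda>y. N (y j))) A" by simp
      also have "\<dots> = (\<integral>\<^sup>+y. indicator B (ang y) * indicator A (N (y j)) \<partial>V)"
        by (rule emeasure_distr_density) measurable
      also have "\<dots> = emeasure (distr V (borel \<Otimes>\<^sub>M borel) T) (A \<times> B)"
        by (subst emeasure_distr)
           (auto simp: T_def simp flip: nn_integral_indicator intro!: nn_integral_cong split: split_indicator)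
      finally show "emeasure m A * emeasure L B = emeasure (distr V (borel \<Otimes>\<^sub>M borel) T) (A \<times> B)"
        by (simp add: mult.commute)
    qed
    have "(\<integral>\<^sup>+y. H y * indicator {y. N (y j) > \<delta>} y \<partial>\<nu>) = (\<integral>\<^sup>+y. (case T y of (r, \<theta>) \<Rightarrow> H (\<lambda>i. r *\<^sub>R \<theta> i)) \<partial>V)"
      unfolding V_def using \<delta>
      by (subst nn_integral_density)
         (auto intro!: nn_integral_cong simp: T_def ang_def split: split_indicator)
    also have "\<dots> = (\<integral>\<^sup>+z. (case z of (r, \<theta>) \<Rightarrow> H (\<lambda>i. r *\<^sub>R \<theta> i)) \<partial>(m \<Otimes>\<^sub>M L))"
      unfolding prod by (subst nn_integral_distr) auto
    also have "\<dots> = (\<integral>\<^sup>+r. \<integral>\<^sup>+\<theta>. H (\<lambda>i. r *\<^sub>R \<theta> i) \<partial>L \<partial>m)"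
      by (subst L.nn_integral_fst[symmetric]) auto
    also have "\<dots> = (\<integral>\<^sup>+r. E r \<partial>m)" by (simp add: EL)
    also have "\<dots> = (\<integral>\<^sup>+r. (E r * ennreal (\<alpha> * r powr (- \<alpha> - 1))) * indicator {r. r > \<delta>} r \<partial>lborel)"
      unfolding m_def
      by (subst nn_integral_density) (auto intro!: nn_integral_cong split: split_indicator simp: mult.commute)
    finally show ?thesis .
  qed
  have "(\<integral>\<^sup>+y. H y * indicator {y. N (y j) > 0} y \<partial>\<nu>) =
        (\<integral>\<^sup>+r. (E r * ennreal (\<alpha> * r powr (- \<alpha> - 1))) * indicator {r. r > 0} r \<partial>lborel)"
    using trunc by (subst (1 2) nn_integral_positive_part_SUP) simp_all
  then show ?thesis
    by (simp add: E_def ang_def greaterThan_def)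
qed

section \<open>Topology and measurability of windows\<close>

lemma topspace_window_top: "topspace (window_top s t) = (\<Pi>\<^sub>E i\<in>{s..t}. UNIV)"
  by (simp add: window_top_def)

lemma continuous_map_window_coordinate:
  "i \<in> {s..t} \<Longrightarrow> continuous_map (window_top s t) euclidean (\<lambda>x. x i)"
  unfolding window_top_def by (rule continuous_map_product_projection)

lemma continuous_map_into_fun_space:
  fixes f :: "'a \<Rightarrow> int \<Rightarrow> real ^ 'd"
  assumes "\<And>i. continuous_map T euclidean (\<lambda>x. f x i)"
  shows "continuous_map T euclidean f"
  unfolding euclidean_product_topology[symmetric]
  by (rule continuous_map_coordinatewise_then_product) (auto simp: assms)

lemma continuous_map_restrict_window:
  "continuous_map euclidean (window_top s t) (\<lambda>y :: int \<Rightarrow> real ^ 'd. restrict y {s..t})"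
  unfolding window_top_def
proof (rule continuous_map_coordinatewise_then_product)
  fix i assume "i \<in> {s..t}"
  then have "(\<lambda>y :: int \<Rightarrow> real ^ 'd. restrict y {s..t} i) = (\<lambda>y. y i)" by auto
  then show "continuous_map euclidean euclidean (\<lambda>y :: int \<Rightarrow> real ^ 'd. restrict y {s..t} i)"
    by (simp only: continuous_map_iff_continuous2 continuous_on_product_coordinates)
qed auto

text \<open>A function of the coordinates in the window is unchanged when a window is extended by zero to
  a sequence. So continuous test functions on windows can be written as continuous functions of
  whole sequences.\<close>
lemma continuous_map_window_cylinder:
  fixes F :: "(int \<Rightarrow> real ^ 'd) \<Rightarrow> real"
  assumes "continuous_on UNIV F" and "\<And>x. F (restrict x {s..t}) = F x"
  shows "continuous_map (window_top s t) euclideanreal F"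
proof -
  define e where "e x = (\<lambda>i. if i \<in> {s..t} then x i else 0)" for x :: "int \<Rightarrow> real ^ 'd"
  have "continuous_map (window_top s t) euclidean (\<lambda>x. e x i)" for i
    by (cases "i \<in> {s..t}") (auto simp: e_def intro: continuous_map_window_coordinate)
  then have "continuous_map (window_top s t) euclidean e"
    by (rule continuous_map_into_fun_space)
  moreover have "continuous_map euclidean euclideanreal F"
    using assms by simp
  ultimately have "continuous_map (window_top s t) euclideanreal (F \<circ> e)"
    by (rule continuous_map_compose)
  moreover have "F \<circ> e = F"
  proof
    fix x
    have "restrict (e x) {s..t} = restrict x {s..t}" by (auto simp: e_def)
    then show "(F \<circ> e) x = F x" using assms(2)[of "e x"] assms(2)[of x] by simp
  qed
  ultimately show ?thesis by simp
qed

lemma space_borel_on [simp]: "space (borel_on T) = topspace T"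
  unfolding borel_on_def by (rule space_measure_of) (auto dest: openin_subset)

lemma openin_borel_on: "openin T U \<Longrightarrow> U \<in> sets (borel_on T)"
  unfolding borel_on_def by (subst sets_measure_of) (auto dest: openin_subset)

lemma closedin_borel_on:
  assumes "closedin T K"
  shows "K \<in> sets (borel_on T)"
proof -
  have "topspace T - K \<in> sets (borel_on T)"
    using assms by (intro openin_borel_on) (auto simp: closedin_def)
  then have "space (borel_on T) - (topspace T - K) \<in> sets (borel_on T)"
    by (rule sets.compl_sets)
  moreover have "topspace T - (topspace T - K) = K"
    using closedin_subset[OF assms] by auto
  ultimately show ?thesis by simp
qed

lemma measurable_into_borel_on:
  assumes "f \<in> space M \<rightarrow> topspace T" "\<And>U. openin T U \<Longrightarrow> f -` U \<inter> space M \<in> sets M"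
  shows "f \<in> M \<rightarrow>\<^sub>M borel_on T"
  unfolding borel_on_def
  by (rule measurable_measure_of) (use assms in \<open>auto dest: openin_subset\<close>)

lemma measurable_from_borel_on:
  fixes F :: "'a \<Rightarrow> real"
  assumes "continuous_map T euclideanreal F"
  shows "F \<in> borel_measurable (borel_on T)"
proof (rule borel_measurableI)
  fix S :: "real set" assume "open S"
  then have "openin T {x \<in> topspace T. F x \<in> S}"
    using assms by (intro openin_continuous_map_preimage[where Y = euclideanreal]) auto
  then show "F -` S \<inter> space (borel_on T) \<in> sets (borel_on T)"
    by (auto dest!: openin_borel_on simp: vimage_def Int_def conj_commute)
qed

lemma measurable_restrict_window:
  "(\<lambda>y :: int \<Rightarrow> real ^ 'd. restrict y {s..t}) \<in> borel \<rightarrow>\<^sub>M borel_on (window_top s t)"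
proof (rule measurable_into_borel_on)
  fix U :: "(int \<Rightarrow> real ^ 'd) set" assume "openin (window_top s t) U"
  then have "openin euclidean {y \<in> topspace euclidean. restrict y {s..t} \<in> U}"
    by (rule openin_continuous_map_preimage[OF continuous_map_restrict_window])
  then show "(\<lambda>y. restrict y {s..t}) -` U \<inter> space borel \<in> sets borel"
    by (simp add: vimage_def)
qed (auto simp: topspace_window_top)

lemma closedin_window_singleton:
  assumes "z \<in> topspace (window_top s t :: (int \<Rightarrow> real ^ 'd) topology)"
  shows "closedin (window_top s t) {z}"
proof -
  have "Hausdorff_space (window_top s t :: (int \<Rightarrow> real ^ 'd) topology)"
    unfolding window_top_def by (simp add: Hausdorff_space_product_topology)
  then show ?thesis using assms by (simp add: closedin_Hausdorff_singleton)
qed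

text \<open>Points of the window are closed, so the punctured window is open in the window and its Borel
  sets are Borel in the window.\<close>
lemma openin_punctured_window:
  "openin (punctured_window_top s t) U \<longleftrightarrow>
     openin (window_top s t) U \<and> (\<lambda>j\<in>{s..t}. 0 :: real ^ 'd) \<notin> U"
proof -
  have "openin (window_top s t) (topspace (window_top s t) - {\<lambda>j\<in>{s..t}. 0 :: real ^ 'd})"
    by (intro openin_diff openin_topspace closedin_window_singleton) (auto simp: topspace_window_top)
  then show ?thesis
    unfolding punctured_window_top_def openin_open_subtopology
    by (auto simp: openin_open_subtopology dest: openin_subset)
qed

lemma topspace_punctured_window:
  "topspace (punctured_window_top s t) = topspace (window_top s t) - {\<lambda>j\<in>{s..t}. 0 :: real ^ 'd}"
  by (auto simp: punctured_window_top_def)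

text \<open>The boxes are stable under intersection and contain a countable basis of the topology. They
  are the generator on which measures on the space of sequences are compared.\<close>
lemma sets_borel_open_boxes:
  "sets (borel :: (int \<Rightarrow> real ^ 'd) measure) =
     sigma_sets UNIV {Pi\<^sub>E UNIV U | U. (\<forall>i. open (U i)) \<and> finite {i. U i \<noteq> UNIV}}"
    (is "_ = sigma_sets UNIV ?E")
proof
  obtain K :: "(int \<Rightarrow> real ^ 'd) set set" where K: "topological_basis K" "countable K"
    "\<forall>k\<in>K. \<exists>X. (k = Pi\<^sub>E UNIV X) \<and> (\<forall>i. open (X i)) \<and> finite {i. X i \<noteq> UNIV}"
    using product_topology_countable_basis by metis
  have "sets (borel :: (int \<Rightarrow> real ^ 'd) measure) = sigma_sets UNIV K"
    by (subst borel_eq_countable_basis[OF K(2,1)]) simp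
  also have "\<dots> \<subseteq> sigma_sets UNIV ?E"
    using K(3) by (intro sigma_sets_mono') blast
  finally show "sets (borel :: (int \<Rightarrow> real ^ 'd) measure) \<subseteq> sigma_sets UNIV ?E" .
  have "?E \<subseteq> sets borel"
    by (auto intro!: borel_open open_PiE)
  then show "sigma_sets UNIV ?E \<subseteq> sets borel"
    using sets.sigma_sets_subset[of ?E borel] by simp
qed

section \<open>Test functions increasing to indicators\<close>

text \<open>Intersecting with the ball of radius \<open>n\<close> serves two purposes: the functions have bounded
  support, as vague convergence demands, and the complement is never empty, a case in which
  \<^const>\<open>infdist\<close> would be 0 by convention.\<close>
definition bump :: "(real ^ 'd) set \<Rightarrow> nat \<Rightarrow> real ^ 'd \<Rightarrow> real" where
  "bump U n x = min 1 (real n * infdist x (- (U \<inter> ball 0 (real n))))"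

lemma bump_bounds: "0 \<le> bump U n x" "bump U n x \<le> 1"
  by (auto simp: bump_def infdist_nonneg)

lemma continuous_on_bump: "continuous_on A (bump U n)"
  unfolding bump_def by (intro continuous_intros)

lemma bump_eq_0:
  assumes "x \<notin> U \<or> norm x \<ge> real n"
  shows "bump U n x = 0"
  using assms by (auto simp: bump_def infdist_zero)

lemma compl_ball_nonempty: "- (U \<inter> ball 0 (real n)) \<noteq> ({} :: (real ^ 'd) set)"
proof -
  obtain v :: "real ^ 'd" where "norm v = real n" by (rule vector_choose_size[of "real n"]) auto
  then have "v \<in> - (U \<inter> ball 0 (real n))" by simp
  then show ?thesis by blast
qed

lemma bump_mono: "bump U m x \<le> bump U n x" if "m \<le> n"
proof -
  have "infdist x (- (U \<inter> ball 0 (real m))) \<le> infdist x (- (U \<inter> ball 0 (real n)))"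
    using that by (intro infdist_mono compl_ball_nonempty) auto
  then have "real m * infdist x (- (U \<inter> ball 0 (real m))) \<le> real n * infdist x (- (U \<inter> ball 0 (real n)))"
    using that by (intro mult_mono) (auto simp: infdist_nonneg)
  then show ?thesis unfolding bump_def by linarith
qed

lemma bump_LIMSEQ:
  assumes "open U"
  shows "(\<lambda>n. bump U n x) \<longlonglongrightarrow> indicator U x"
proof (cases "x \<in> U")
  case True
  then obtain e where e: "e > 0" "ball x e \<subseteq> U" using assms by (auto simp: open_contains_ball)
  have "bump U n x = 1" if n: "norm x + e \<le> real n" "1 / e \<le> real n" for n
  proof -
    have "e \<le> dist x y" if "y \<in> - (U \<inter> ball 0 (real n))" for y
    proof (rule ccontr)
      assume *: "\<not> e \<le> dist x y"
      then have "norm y < real n"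
        using n(1) norm_triangle_ineq2[of y x] by (simp add: dist_norm norm_minus_commute[of y x])
      then have "y \<in> ball 0 (real n)" by simp
      moreover have "y \<in> ball x e" using * by simp
      ultimately show False using that e(2) by blast
    qed
    then have "e \<le> infdist x (- (U \<inter> ball 0 (real n)))"
      unfolding infdist_notempty[OF compl_ball_nonempty] by (intro cINF_greatest compl_ball_nonempty)
    then have "1 / e * e \<le> real n * infdist x (- (U \<inter> ball 0 (real n)))"
      using n(2) e(1) by (intro mult_mono) auto
    then show ?thesis using e(1) by (simp add: bump_def)
  qed
  moreover have "eventually (\<lambda>n. norm x + e \<le> real n \<and> 1 / e \<le> real n) sequentially"
    by (intro eventually_conj filterlim_real_sequentially[THEN filterlim_at_top[THEN iffD1], rule_format])
  ultimately show ?thesis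
    using True by (intro tendsto_eventually) (auto elim!: eventually_mono)
next
  case False
  then show ?thesis by (simp add: bump_eq_0)
qed

definition ramp :: "nat \<Rightarrow> real \<Rightarrow> real" where
  "ramp n r = min 1 (real n * max 0 (r - 1))"

lemma ramp_bounds: "0 \<le> ramp n r" "ramp n r \<le> 1" "r \<le> 1 \<Longrightarrow> ramp n r = 0"
  by (auto simp: ramp_def)

lemma continuous_on_ramp: "continuous_on A (ramp n)"
  unfolding ramp_def by (intro continuous_intros)

lemma ramp_mono: "m \<le> n \<Longrightarrow> ramp m r \<le> ramp n r"
  using mult_right_mono[of "real m" "real n" "max 0 (r - 1)"] unfolding ramp_def by auto

lemma ramp_LIMSEQ: "(\<lambda>n. ramp n r) \<longlonglongrightarrow> indicator {1<..} r"
proof (cases "r > 1")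
  case True
  have "eventually (\<lambda>n. 1 / (r - 1) \<le> real n) sequentially"
    by (intro filterlim_real_sequentially[THEN filterlim_at_top[THEN iffD1], rule_format])
  then have "eventually (\<lambda>n. ramp n r = 1) sequentially"
  proof eventually_elim
    case (elim n)
    then show ?case using True by (simp add: ramp_def field_simps)
  qed
  then show ?thesis using True by (simp add: tendsto_eventually)
next
  case False
  then show ?thesis by (simp add: ramp_bounds)
qed

section \<open>Exceedances of the tail measure\<close>

locale tail_process_setting =
  fixes N :: "real ^ 'd \<Rightarrow> real"
    and M :: "'w measure" and X :: "int \<Rightarrow> 'w \<Rightarrow> real ^ 'd"
    and \<nu>w :: "int \<Rightarrow> int \<Rightarrow> (int \<Rightarrow> real ^ 'd) measure"
    and \<alpha> :: real
    and P :: "'v measure" and Y :: "int \<Rightarrow> 'v \<Rightarrow> real ^ 'd"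
    and \<nu> :: "(int \<Rightarrow> real ^ 'd) measure"
  assumes norm: "is_norm N"
    and prob_M: "prob_space M" and X_measurable: "\<And>j. X j \<in> borel_measurable M"
    and stationary: "stationary M X"
    and reg_var: "regularly_varying N M X \<nu>w"
    and tail_index: "has_tail_index N M X \<alpha>"
    and prob_P: "prob_space P" and Y_measurable: "\<And>j. Y j \<in> borel_measurable P"
    and tail_process: "is_tail_process N M X \<alpha> P Y"
    and tail_measure: "is_tail_measure \<nu>w \<nu>"
begin

sublocale M: prob_space M by (rule prob_M)
sublocale P: prob_space P by (rule prob_P)

lemma N_measurable [measurable]: "N \<in> borel_measurable borel"
  by (rule is_norm_borel(2)[OF norm])

lemma N_0 [simp]: "N 0 = 0" and N_nonneg: "0 \<le> N x" and N_scale: "c \<ge> 0 \<Longrightarrow> N (c *\<^sub>R x) = c * N x"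
  using norm by (auto simp: is_norm_def)

declare X_measurable [measurable] Y_measurable [measurable]

lemma \<nu>_sets [measurable_cong]: "sets \<nu> = sets borel"
  using tail_measure by (simp add: is_tail_measure_def)

lemma \<nu>_space: "space \<nu> = UNIV"
  using sets_eq_imp_space_eq[OF \<nu>_sets] by simp

lemma \<alpha>_pos: "\<alpha> > 0"
  using tail_index by (simp add: has_tail_index_def)

definition tail_prob :: "real \<Rightarrow> real" where
  "tail_prob u = \<P>(\<omega> in M. N (X 0 \<omega>) > u)"

lemma tail_prob_ratio: "c > 0 \<Longrightarrow> ((\<lambda>u. tail_prob (c * u) / tail_prob u) \<longlongrightarrow> c powr (- \<alpha>)) at_top"
  using tail_index by (simp add: has_tail_index_def tail_prob_def)

text \<open>Division by 0 yields 0, so the convergence of the ratio for \<open>c = 1\<close> to the limit 1 already forces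
  the denominators to be eventually non-zero.\<close>
lemma tail_prob_pos: "eventually (\<lambda>u. tail_prob u > 0) at_top"
proof -
  have "eventually (\<lambda>u. tail_prob (1 * u) / tail_prob u > 0) at_top"
    by (rule order_tendstoD(1)[OF tail_prob_ratio[of 1]]) auto
  then show ?thesis
  proof eventually_elim
    case (elim u)
    then have "tail_prob u \<noteq> 0" by auto
    then show ?case by (simp add: tail_prob_def zero_less_measure_iff)
  qed
qed

lemma X_seq_measurable [measurable]: "(\<lambda>\<omega> i. c *\<^sub>R X (i + h) \<omega>) \<in> borel_measurable M"
  by (rule measurable_sequence) measurable

lemma Y_seq_measurable [measurable]: "(\<lambda>\<omega> i. c *\<^sub>R Y (i - h) \<omega>) \<in> borel_measurable P"
  by (rule measurable_sequence) measurable

lemma scaled_window_eq: "scaled_window X s t u \<omega> = restrict (\<lambda>i. (1 / u) *\<^sub>R X i \<omega>) {s..t}"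
  by (simp add: scaled_window_def)

lemma scaled_window_measurable: "scaled_window X s t u \<in> M \<rightarrow>\<^sub>M borel_on (window_top s t)"
  unfolding scaled_window_eq[abs_def]
  using measurable_compose[OF X_seq_measurable[of "1 / u" 0] measurable_restrict_window] by simp

text \<open>The window measure is the image of \<open>\<nu>\<close> restricted to the sequences that do not vanish on the
  window; a test function with value 0 at the zero sequence does not see the rest.\<close>
lemma window_measure_nn_integral:
  fixes F :: "(int \<Rightarrow> real ^ 'd) \<Rightarrow> real"
  assumes st: "s \<le> t" and cont: "continuous_on UNIV F"
    and cyl: "\<And>x. F (restrict x {s..t}) = F x" and F0: "F (\<lambda>_. 0) = 0"
  shows "(\<integral>\<^sup>+x. ennreal (F x) \<partial>\<nu>w s t) = (\<integral>\<^sup>+y. ennreal (F y) \<partial>\<nu>)"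
proof -
  let ?T = "punctured_window_top s t :: (int \<Rightarrow> real ^ 'd) topology"
  let ?r = "\<lambda>y :: int \<Rightarrow> real ^ 'd. restrict y {s..t}"
  define \<Omega> where "\<Omega> = {y. ?r y \<in> topspace ?T}"
  have pre: "{y. ?r y \<in> U} \<in> sets borel" if "openin ?T U" for U
  proof -
    have "U \<in> sets (borel_on (window_top s t))"
      using that by (intro openin_borel_on) (simp add: openin_punctured_window)
    from measurable_sets[OF measurable_restrict_window this] show ?thesis by (simp add: vimage_def)
  qed
  have \<Omega> [measurable]: "\<Omega> \<in> sets borel" unfolding \<Omega>_def by (rule pre) simp
  have \<Omega>': "\<Omega> \<inter> space \<nu> \<in> sets \<nu>" using \<Omega> by (simp add: \<nu>_space \<nu>_sets)
  have r: "?r \<in> restrict_space \<nu> \<Omega> \<rightarrow>\<^sub>M borel_on ?T"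
  proof (rule measurable_into_borel_on)
    fix U assume "openin ?T U"
    from pre[OF this] show "?r -` U \<inter> space (restrict_space \<nu> \<Omega>) \<in> sets (restrict_space \<nu> \<Omega>)"
      by (auto simp: sets_restrict_space space_restrict_space \<nu>_space \<nu>_sets image_iff vimage_def Int_commute)
  qed (auto simp: \<Omega>_def space_restrict_space \<nu>_space)
  have radon: "radon_measure_on ?T (\<nu>w s t)"
    using reg_var st by (simp add: regularly_varying_def)
  have "\<nu>w s t = distr (restrict_space \<nu> \<Omega>) (borel_on ?T) ?r"
  proof (rule measure_eqI)
    fix A assume "A \<in> sets (\<nu>w s t)"
    then have A: "A \<in> sets (borel_on ?T)" using radon by (simp add: radon_measure_on_def)
    then have sub: "A \<subseteq> topspace ?T" using sets.sets_into_space by fastforce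
    have "emeasure (distr (restrict_space \<nu> \<Omega>) (borel_on ?T) ?r) A =
        emeasure (restrict_space \<nu> \<Omega>) (?r -` A \<inter> space (restrict_space \<nu> \<Omega>))"
      by (rule emeasure_distr[OF r A])
    also have "\<dots> = emeasure \<nu> (?r -` A \<inter> space (restrict_space \<nu> \<Omega>))"
      by (rule emeasure_restrict_space[OF \<Omega>']) (auto simp: space_restrict_space)
    also have "?r -` A \<inter> space (restrict_space \<nu> \<Omega>) = {y. ?r y \<in> A}"
      using sub by (auto simp: space_restrict_space \<nu>_space \<Omega>_def)
    also have "emeasure \<nu> {y. ?r y \<in> A} = emeasure (\<nu>w s t) A"
      using tail_measure st A by (auto simp: is_tail_measure_def)
    finally show "emeasure (\<nu>w s t) A = emeasure (distr (restrict_space \<nu> \<Omega>) (borel_on ?T) ?r) A" by (rule sym)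
  qed (use radon in \<open>simp add: radon_measure_on_def\<close>)
  moreover have "(\<lambda>x. ennreal (F x)) \<in> borel_measurable (borel_on ?T)"
    using continuous_map_window_cylinder[OF cont cyl]
    by (intro measurable_compose[OF measurable_from_borel_on measurable_ennreal])
       (simp add: punctured_window_top_def continuous_map_from_subtopology)
  ultimately have "(\<integral>\<^sup>+x. ennreal (F x) \<partial>\<nu>w s t) = (\<integral>\<^sup>+y. ennreal (F (?r y)) \<partial>restrict_space \<nu> \<Omega>)"
    using r by (simp add: nn_integral_distr)
  also have "\<dots> = (\<integral>\<^sup>+y. ennreal (F y) * indicator \<Omega> y \<partial>\<nu>)"
    using \<Omega>' by (simp add: nn_integral_restrict_space cyl)
  also have "\<dots> = (\<integral>\<^sup>+y. ennreal (F y) \<partial>\<nu>)"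
  proof (intro nn_integral_cong)
    fix y
    have "F y = 0" if "y \<notin> \<Omega>"
    proof -
      have "?r y = ?r (\<lambda>_. 0)"
        using that by (auto simp: \<Omega>_def topspace_punctured_window topspace_window_top)
      then show ?thesis using F0 cyl[of y] cyl[of "\<lambda>_. 0"] by simp
    qed
    then show "ennreal (F y) * indicator \<Omega> y = ennreal (F y)" by (auto split: split_indicator)
  qed
  finally show ?thesis .
qed

text \<open>This is where regular variation enters. Both sides are limits of the expectation of
  \<open>F (X / u)\<close> divided by the probability of \<open>N (X 0) > u\<close>. On the left the limit is taken by vague
  convergence, for which \<open>F\<close> must vanish near 0 and near infinity. On the right stationarity moves
  the coordinate \<open>j\<close> to 0, and the
  rescaling of the threshold from \<open>u\<close> to \<open>\<delta> u\<close> costs the factor \<open>\<delta> powr (- \<alpha>)\<close> by the tail index;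
  since \<open>F\<close> vanishes unless \<open>N (x j) > \<delta>\<close>, the expectation is one conditional on
  \<open>N (X 0) > \<delta> u\<close> and the tail process appears by weak convergence. The test functions vanish continuously at the
  boundary of \<open>N (x j) > \<delta>\<close>, so both convergences apply whatever mass the limits have there.\<close>
lemma tail_measure_exceedance_test_function:
  fixes F :: "(int \<Rightarrow> real ^ 'd) \<Rightarrow> real"
  assumes j: "j \<in> {s..t}" and \<delta>: "\<delta> > 0" and cont: "continuous_on UNIV F"
    and cyl: "\<And>x. F (restrict x {s..t}) = F x" and F_bounds: "\<And>x. 0 \<le> F x" "\<And>x. F x \<le> 1"
    and small: "\<And>x. N (x j) \<le> \<delta> \<Longrightarrow> F x = 0"
    and large: "\<And>x i. i \<in> {s..t} \<Longrightarrow> norm (x i) \<ge> R \<Longrightarrow> F x = 0"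
  shows "(\<integral>\<^sup>+y. ennreal (F y) \<partial>\<nu>) =
    ennreal (\<delta> powr (- \<alpha>)) * (\<integral>\<^sup>+\<omega>. ennreal (F (\<lambda>i. \<delta> *\<^sub>R Y (i - j) \<omega>)) \<partial>P)"
proof -
  let ?T = "punctured_window_top s t :: (int \<Rightarrow> real ^ 'd) topology"
  let ?W = "window_top s t :: (int \<Rightarrow> real ^ 'd) topology"
  have st: "s \<le> t" using j by simp
  have F_meas [measurable]: "F \<in> borel_measurable borel"
    by (rule borel_measurable_continuous_onI[OF cont])
  have contW: "continuous_map ?W euclideanreal F"
    by (rule continuous_map_window_cylinder[OF cont cyl])
  have F0: "F (\<lambda>_. 0) = 0" using \<delta> by (intro small) simp
  have Fz: "F (\<lambda>j\<in>{s..t}. 0) = 0" using cyl[of "\<lambda>_. 0"] F0 by simp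
  define G where "G x = F (\<lambda>i. \<delta> *\<^sub>R x (i - j))" for x :: "int \<Rightarrow> real ^ 'd"
  have G_cont: "continuous_on UNIV G"
    unfolding G_def
    by (intro continuous_on_compose2[OF cont] continuous_on_coordinatewise_then_product
        continuous_intros continuous_on_product_coordinates) auto
  have G_cyl: "G (restrict x {s - j..t - j}) = G x" for x
  proof -
    have "restrict (\<lambda>i. \<delta> *\<^sub>R restrict x {s - j..t - j} (i - j)) {s..t} = restrict (\<lambda>i. \<delta> *\<^sub>R x (i - j)) {s..t}"
      by (auto simp: restrict_def)
    then show ?thesis
      unfolding G_def using cyl[of "\<lambda>i. \<delta> *\<^sub>R restrict x {s - j..t - j} (i - j)"] cyl[of "\<lambda>i. \<delta> *\<^sub>R x (i - j)"]
      by simp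
  qed
  have G_meas [measurable]: "G \<in> borel_measurable borel"
    by (rule borel_measurable_continuous_onI[OF G_cont])
  have G_bounds: "0 \<le> G x" "G x \<le> 1" for x by (simp_all add: G_def F_bounds)
  define K where "K = {x \<in> topspace ?W. N (x j) \<in> {\<delta>..}} \<inter> (\<Pi>\<^sub>E i\<in>{s..t}. cball 0 R)"
  have N_contW: "continuous_map ?W euclideanreal (\<lambda>x. N (x j))"
    using continuous_map_compose[OF continuous_map_window_coordinate[OF j], of euclideanreal N]
    by (simp add: o_def is_norm_borel(1)[OF norm])
  have "closedin ?W {x \<in> topspace ?W. N (x j) \<in> {\<delta>..}}"
    by (rule closedin_continuous_map_preimage[OF N_contW]) simp
  moreover have "compactin ?W (\<Pi>\<^sub>E i\<in>{s..t}. cball 0 R)"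
    unfolding window_top_def by (simp add: compactin_PiE)
  ultimately have K_W: "compactin ?W K"
    unfolding K_def by (rule closed_Int_compactin)
  have K_sub: "K \<subseteq> topspace ?T"
    using \<delta> j by (auto simp: K_def topspace_punctured_window)
  have K_T: "compactin ?T K"
    using K_W K_sub by (simp add: punctured_window_top_def compactin_subtopology topspace_window_top)
  have "Hausdorff_space ?W"
    unfolding window_top_def by (simp add: Hausdorff_space_product_topology)
  then have "closedin ?T K"
    using K_T by (intro compactin_imp_closedin) (auto simp: punctured_window_top_def Hausdorff_space_subtopology)
  then have K_sets: "K \<in> sets (borel_on ?T)" by (rule closedin_borel_on)
  have F_off_K: "F x = 0" if "x \<in> topspace ?T - K" for x
    using that small[of x] large[of _ x]
    by (auto simp: K_def topspace_punctured_window topspace_window_top PiE_iff not_le)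
  have contT: "continuous_map ?T euclideanreal F"
    using contW by (simp add: punctured_window_top_def continuous_map_from_subtopology)
  have radon: "radon_measure_on ?T (\<nu>w s t)"
    using reg_var st by (simp add: regularly_varying_def)
  have radon_compact: "emeasure (\<nu>w s t) K < top"
    using K_sets K_T radon unfolding radon_measure_on_def by blast
  have \<nu>w_F: "F \<in> borel_measurable (\<nu>w s t)"
    using measurable_from_borel_on[OF contT] radon
    by (simp add: radon_measure_on_def cong: measurable_cong_sets)
  have fin: "(\<integral>\<^sup>+x. ennreal (F x) \<partial>\<nu>w s t) < \<infinity>"
  proof -
    have "(\<integral>\<^sup>+x. ennreal (F x) \<partial>\<nu>w s t) \<le> (\<integral>\<^sup>+x. indicator K x \<partial>\<nu>w s t)"
    proof (intro nn_integral_mono)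
      fix x assume "x \<in> space (\<nu>w s t)"
      then have "x \<in> topspace ?T" using radon by (simp add: radon_measure_on_def)
      then show "ennreal (F x) \<le> indicator K x"
        using F_off_K[of x] F_bounds(2)[of x] by (auto split: split_indicator)
    qed
    also have "\<dots> = emeasure (\<nu>w s t) K"
      using K_sets radon by (simp add: radon_measure_on_def)
    also have "\<dots> < \<infinity>"
      using radon_compact by simp
    finally show ?thesis .
  qed
  \<comment> \<open>\<open>A\<close> is the numerator in the vague limit for the window \<open>s..t\<close>, and \<open>B\<close> the one in the weak limit
     for the shifted window, which contains the time 0.\<close>
  define A where "A u = (\<integral>\<omega>. F (\<lambda>i. (1 / u) *\<^sub>R X i \<omega>) \<partial>M)" for u
  define B where "B u = (\<integral>\<omega>. G (\<lambda>i. (1 / u) *\<^sub>R X i \<omega>) \<partial>M)" for u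
  have X_seq [measurable]: "(\<lambda>\<omega> i. c *\<^sub>R X i \<omega>) \<in> borel_measurable M" for c
    using X_seq_measurable[of c 0] by simp

  have vague: "((\<lambda>u. A u / tail_prob u) \<longlongrightarrow> (\<integral>x. F x \<partial>\<nu>w s t)) at_top"
  proof -
    let ?\<mu> = "\<lambda>u. distr M (borel_on ?W) (scaled_window X s t u)"
    have "((\<lambda>u. \<integral>x. F x \<partial>scale_measure (ennreal (1 / tail_prob u)) (restrict_space (?\<mu> u) (topspace ?T)))
        \<longlongrightarrow> (\<integral>x. F x \<partial>\<nu>w s t)) at_top"
      using reg_var st contT K_T F_off_K
      unfolding regularly_varying_def vaguely_converges_def tail_prob_def by blast
    moreover have "(\<integral>x. F x \<partial>scale_measure (ennreal (1 / tail_prob u)) (restrict_space (?\<mu> u) (topspace ?T))) = A u / tail_prob u" for u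
    proof -
      have F_W [measurable]: "F \<in> borel_measurable (borel_on ?W)" by (rule measurable_from_borel_on[OF contW])
      have top: "topspace ?T \<inter> space (?\<mu> u) \<in> sets (?\<mu> u)"
      proof -
        have "openin ?W (topspace ?T)"
          using openin_topspace[of ?T] unfolding openin_punctured_window by blast
        from openin_borel_on[OF this] show ?thesis
          by (simp add: topspace_punctured_window Int_absorb2)
      qed
      have F_r [measurable]: "F \<in> borel_measurable (restrict_space (?\<mu> u) (topspace ?T))"
        by (intro measurable_restrict_space1) simp
      note [measurable] = scaled_window_measurable
      have "(\<integral>x. F x \<partial>scale_measure (ennreal (1 / tail_prob u)) (restrict_space (?\<mu> u) (topspace ?T))) =
          enn2real (\<integral>\<^sup>+x. ennreal (F x) \<partial>scale_measure (ennreal (1 / tail_prob u)) (restrict_space (?\<mu> u) (topspace ?T)))"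
        by (rule integral_eq_nn_integral) (auto simp: F_bounds)
      also have "(\<integral>\<^sup>+x. ennreal (F x) \<partial>scale_measure (ennreal (1 / tail_prob u)) (restrict_space (?\<mu> u) (topspace ?T))) =
          ennreal (1 / tail_prob u) * (\<integral>\<^sup>+x. ennreal (F x) * indicator (topspace ?T) x \<partial>?\<mu> u)"
        by (simp add: nn_integral_scale_measure nn_integral_restrict_space[OF top])
      also have "(\<integral>\<^sup>+x. ennreal (F x) * indicator (topspace ?T) x \<partial>?\<mu> u) = (\<integral>\<^sup>+x. ennreal (F x) \<partial>?\<mu> u)"
        using Fz by (intro nn_integral_cong) (auto simp: topspace_punctured_window split: split_indicator)
      also have "\<dots> = (\<integral>\<^sup>+\<omega>. ennreal (F (\<lambda>i. (1 / u) *\<^sub>R X i \<omega>)) \<partial>M)"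
        by (subst nn_integral_distr) (auto simp: scaled_window_eq cyl)
      also have "enn2real (ennreal (1 / tail_prob u) * \<dots>) = A u / tail_prob u"
        unfolding A_def by (subst integral_eq_nn_integral) (auto simp: F_bounds enn2real_mult tail_prob_def)
      finally show ?thesis .
    qed
    ultimately show ?thesis by simp
  qed

  have weak: "((\<lambda>v. B v / tail_prob v) \<longlongrightarrow> (\<integral>\<omega>. G (\<lambda>i. Y i \<omega>) \<partial>P)) at_top"
  proof -
    let ?V = "window_top (s - j) (t - j) :: (int \<Rightarrow> real ^ 'd) topology"
    let ?U = "\<lambda>v. uniform_measure M {\<omega> \<in> space M. N (X 0 \<omega>) > v}"
    have contV: "continuous_map ?V euclideanreal G"
      by (rule continuous_map_window_cylinder[OF G_cont G_cyl])
    note G_V [measurable] = measurable_from_borel_on[OF contV]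
    have "bounded (G ` topspace ?V)"
      by (rule boundedI[of _ 1]) (use G_bounds in \<open>auto simp: abs_le_iff intro: order_trans[of _ 0]\<close>)
    then have lim: "((\<lambda>v. \<integral>x. G x \<partial>distr (?U v) (borel_on ?V) (scaled_window X (s - j) (t - j) v)) \<longlongrightarrow>
        (\<integral>x. G x \<partial>distr P (borel_on ?V) (\<lambda>\<omega>. \<lambda>i\<in>{s - j..t - j}. Y i \<omega>))) at_top"
      using tail_process st contV unfolding is_tail_process_def weakly_converges_def by simp
    have "(\<lambda>\<omega> i. Y i \<omega>) \<in> borel_measurable P" using Y_seq_measurable[of 1 0] by simp
    then have Y_win: "(\<lambda>\<omega>. \<lambda>i\<in>{s - j..t - j}. Y i \<omega>) \<in> P \<rightarrow>\<^sub>M borel_on ?V"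
      by (rule measurable_compose[OF _ measurable_restrict_window])
    have lim_eq: "(\<integral>x. G x \<partial>distr P (borel_on ?V) (\<lambda>\<omega>. \<lambda>i\<in>{s - j..t - j}. Y i \<omega>)) = (\<integral>\<omega>. G (\<lambda>i. Y i \<omega>) \<partial>P)"
      by (subst integral_distr[OF Y_win G_V]) (simp add: G_cyl)
    have "eventually (\<lambda>v. (\<integral>x. G x \<partial>distr (?U v) (borel_on ?V) (scaled_window X (s - j) (t - j) v)) = B v / tail_prob v) at_top"
      using eventually_gt_at_top[of 0] tail_prob_pos
    proof eventually_elim
      case (elim v)
      let ?E = "{\<omega> \<in> space M. N (X 0 \<omega>) > v}"
      note [measurable] = scaled_window_measurable[of "s - j" "t - j" v]
      have win [measurable]: "scaled_window X (s - j) (t - j) v \<in> ?U v \<rightarrow>\<^sub>M borel_on ?V"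
        by (simp add: uniform_measure_def)
      have "(\<integral>x. G x \<partial>distr (?U v) (borel_on ?V) (scaled_window X (s - j) (t - j) v)) =
          (\<integral>\<omega>. G (\<lambda>i. (1 / v) *\<^sub>R X i \<omega>) \<partial>?U v)"
        by (subst integral_distr[OF win G_V]) (simp add: scaled_window_eq G_cyl)
      also have "\<dots> = enn2real (\<integral>\<^sup>+\<omega>. ennreal (G (\<lambda>i. (1 / v) *\<^sub>R X i \<omega>)) \<partial>?U v)"
        by (rule integral_eq_nn_integral) (auto simp: G_bounds uniform_measure_def)
      also have "(\<integral>\<^sup>+\<omega>. ennreal (G (\<lambda>i. (1 / v) *\<^sub>R X i \<omega>)) \<partial>?U v) =
          (\<integral>\<^sup>+\<omega>. ennreal (G (\<lambda>i. (1 / v) *\<^sub>R X i \<omega>)) * indicator ?E \<omega> \<partial>M) / emeasure M ?E"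
        by (rule nn_integral_uniform_measure) measurable
      also have "(\<integral>\<^sup>+\<omega>. ennreal (G (\<lambda>i. (1 / v) *\<^sub>R X i \<omega>)) * indicator ?E \<omega> \<partial>M) =
          (\<integral>\<^sup>+\<omega>. ennreal (G (\<lambda>i. (1 / v) *\<^sub>R X i \<omega>)) \<partial>M)"
      proof (intro nn_integral_cong)
        fix \<omega> assume "\<omega> \<in> space M"
        moreover have "G (\<lambda>i. (1 / v) *\<^sub>R X i \<omega>) = 0" if "N (X 0 \<omega>) \<le> v"
          unfolding G_def using that elim \<delta> by (intro small) (simp add: N_scale field_simps)
        ultimately show "ennreal (G (\<lambda>i. (1 / v) *\<^sub>R X i \<omega>)) * indicator ?E \<omega> = ennreal (G (\<lambda>i. (1 / v) *\<^sub>R X i \<omega>))"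
          by (auto split: split_indicator)
      qed
      also have "emeasure M ?E = ennreal (tail_prob v)" by (simp add: tail_prob_def M.emeasure_eq_measure)
      also have "(\<integral>\<^sup>+\<omega>. ennreal (G (\<lambda>i. (1 / v) *\<^sub>R X i \<omega>)) \<partial>M) = ennreal (B v)"
        unfolding B_def
        by (intro nn_integral_eq_integral M.integrable_const_bound[of _ 1])
           (auto simp: G_bounds abs_of_nonneg)
      also have "enn2real (ennreal (B v) / ennreal (tail_prob v)) = B v / tail_prob v"
        using elim by (simp add: divide_ennreal B_def G_bounds)
      finally show ?case .
    qed
    from tendsto_cong[OF this] lim show ?thesis by (simp add: lim_eq)
  qed

  have AB: "A u = B (\<delta> * u)" for u
  proof -
    define Q where "Q x = F (\<lambda>i. (1 / u) *\<^sub>R x i)" for x :: "int \<Rightarrow> real ^ 'd"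
    have [measurable]: "Q \<in> borel_measurable borel"
      unfolding Q_def by (intro borel_measurable_continuous_onI continuous_on_compose2[OF cont]
        continuous_on_coordinatewise_then_product continuous_intros continuous_on_product_coordinates) auto
    have Xh: "(\<lambda>\<omega> i. X (i + h) \<omega>) \<in> borel_measurable M" for h using X_seq_measurable[of 1 h] by simp
    have X0: "(\<lambda>\<omega> i. X i \<omega>) \<in> borel_measurable M" using Xh[of 0] by simp
    have "A u = (\<integral>x. Q x \<partial>distr M borel (\<lambda>\<omega> i. X i \<omega>))"
      using X0 by (simp add: A_def Q_def[symmetric] integral_distr)
    also have "\<dots> = (\<integral>x. Q x \<partial>distr M borel (\<lambda>\<omega> i. X (i + (- j)) \<omega>))"
      using stationary unfolding stationary_def by metis
    also have "\<dots> = (\<integral>\<omega>. Q (\<lambda>i. X (i + (- j)) \<omega>) \<partial>M)"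
      by (rule integral_distr[OF Xh]) measurable
    also have "\<dots> = B (\<delta> * u)"
      using \<delta> by (simp add: B_def Q_def G_def)
    finally show ?thesis .
  qed

  have to_top: "filterlim (\<lambda>u. \<delta> * u) at_top at_top"
    using \<delta> by (intro filterlim_tendsto_pos_mult_at_top[OF tendsto_const]) (auto simp: filterlim_ident)
  have "((\<lambda>u. B (\<delta> * u) / tail_prob (\<delta> * u) * (tail_prob (\<delta> * u) / tail_prob u)) \<longlongrightarrow>
      (\<integral>\<omega>. G (\<lambda>i. Y i \<omega>) \<partial>P) * \<delta> powr (- \<alpha>)) at_top"
    by (intro tendsto_mult filterlim_compose[OF weak to_top] tail_prob_ratio \<delta>)
  moreover have "eventually (\<lambda>u. B (\<delta> * u) / tail_prob (\<delta> * u) * (tail_prob (\<delta> * u) / tail_prob u) = A u / tail_prob u) at_top"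
    using filterlim_iff[THEN iffD1, OF to_top, rule_format, OF tail_prob_pos]
    by eventually_elim (simp add: AB)
  ultimately have "((\<lambda>u. A u / tail_prob u) \<longlongrightarrow> (\<integral>\<omega>. G (\<lambda>i. Y i \<omega>) \<partial>P) * \<delta> powr (- \<alpha>)) at_top"
    using tendsto_cong by fast
  from tendsto_unique[OF _ vague this]
  have main: "(\<integral>x. F x \<partial>\<nu>w s t) = \<delta> powr (- \<alpha>) * (\<integral>\<omega>. G (\<lambda>i. Y i \<omega>) \<partial>P)" by simp
  have "(\<integral>\<^sup>+y. ennreal (F y) \<partial>\<nu>) = (\<integral>\<^sup>+x. ennreal (F x) \<partial>\<nu>w s t)"
    by (rule window_measure_nn_integral[OF st cont cyl F0, symmetric])
  also have "\<dots> = ennreal (\<integral>x. F x \<partial>\<nu>w s t)"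
    using fin \<nu>w_F by (simp add: integral_eq_nn_integral F_bounds ennreal_enn2real_if)
  also have "\<dots> = ennreal (\<delta> powr (- \<alpha>)) * ennreal (\<integral>\<omega>. G (\<lambda>i. Y i \<omega>) \<partial>P)"
    unfolding main by (simp add: ennreal_mult' )
  also have "ennreal (\<integral>\<omega>. G (\<lambda>i. Y i \<omega>) \<partial>P) = (\<integral>\<^sup>+\<omega>. ennreal (G (\<lambda>i. Y i \<omega>)) \<partial>P)"
  proof (rule nn_integral_eq_integral[symmetric])
    have "(\<lambda>\<omega> i. Y i \<omega>) \<in> borel_measurable P" using Y_seq_measurable[of 1 0] by simp
    then show "integrable P (\<lambda>\<omega>. G (\<lambda>i. Y i \<omega>))"
      using G_bounds by (intro P.integrable_const_bound[of _ 1] measurable_compose[OF _ G_meas])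
        (auto simp: abs_le_iff intro!: AE_I2 order_trans[of _ 0])
  qed (auto simp: G_bounds)
  finally show ?thesis by (simp add: G_def)
qed

lemma norm_Y0_gt_1: "AE \<omega> in P. N (Y 0 \<omega>) > 1"
proof -
  have "\<P>(\<omega> in P. N (Y 0 \<omega>) > 1) = 1"
    using tail_process by (simp add: is_tail_process_def)
  then show ?thesis by (subst (asm) P.prob_Collect_eq_1) auto
qed

text \<open>Products of bump functions in the coordinates and a ramp in \<open>N (x j) / \<delta>\<close> increase to the
  indicator of the box intersected with \<open>{N (x j) > \<delta>}\<close>. On the side of the tail process the second
  event is almost sure because \<open>N (Y 0) > 1\<close>.\<close>
lemma tail_measure_exceedance_box:
  assumes \<delta>: "\<delta> > 0" and U: "\<And>i. open (U i)" "finite {i. U i \<noteq> UNIV}"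
  shows "(\<integral>\<^sup>+y. indicator (Pi\<^sub>E UNIV U) y * indicator {y. N (y j) > \<delta>} y \<partial>\<nu>) =
    ennreal (\<delta> powr (- \<alpha>)) * (\<integral>\<^sup>+\<omega>. indicator (Pi\<^sub>E UNIV U) (\<lambda>i. \<delta> *\<^sub>R Y (i - j) \<omega>) \<partial>P)"
proof -
  \<comment> \<open>A window that contains \<open>j\<close> and every constrained coordinate of the box.\<close>
  define J where "J = insert j {i. U i \<noteq> UNIV}"
  define s t where "s = Min J" and "t = Max J"
  have "finite J" "J \<noteq> {}" using U by (auto simp: J_def)
  then have J: "J \<subseteq> {s..t}" by (auto simp: s_def t_def)
  then have j: "j \<in> {s..t}" by (auto simp: J_def)
  have off: "U i = UNIV" if "i \<notin> {s..t}" for i using J that by (auto simp: J_def)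
  define F where "F n x = (\<Prod>i\<in>{s..t}. bump (U i) n (x i)) * ramp n (N (x j) / \<delta>)" for n and x :: "int \<Rightarrow> real ^ 'd"
  have F_cont: "continuous_on UNIV (F n)" for n
    unfolding F_def
    by (intro continuous_intros continuous_on_compose2[OF continuous_on_bump[of UNIV]]
        continuous_on_compose2[OF continuous_on_ramp[of UNIV]] continuous_on_compose2[OF is_norm_borel(1)[OF norm]]
        continuous_on_product_coordinates) (use \<delta> in auto)
  have F_meas [measurable]: "F n \<in> borel_measurable borel" for n
    by (rule borel_measurable_continuous_onI[OF F_cont])
  have F_bounds: "0 \<le> F n x" "F n x \<le> 1" for n x
    unfolding F_def by (auto intro!: mult_nonneg_nonneg mult_le_one prod_nonneg prod_le_1 simp: bump_bounds ramp_bounds)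
  have test: "(\<integral>\<^sup>+y. ennreal (F n y) \<partial>\<nu>) =
      ennreal (\<delta> powr (- \<alpha>)) * (\<integral>\<^sup>+\<omega>. ennreal (F n (\<lambda>i. \<delta> *\<^sub>R Y (i - j) \<omega>)) \<partial>P)" for n
  proof (rule tail_measure_exceedance_test_function[OF j \<delta> F_cont])
    show "F n (restrict x {s..t}) = F n x" for x using j by (simp add: F_def)
    show "F n x = 0" if "N (x j) \<le> \<delta>" for x
      using that \<delta> by (simp add: F_def ramp_bounds)
    show "F n x = 0" if "i \<in> {s..t}" "real n \<le> norm (x i)" for x i
      unfolding F_def using that bump_eq_0[of "x i" "U i" n] by (auto intro!: prod_zero)
  qed (rule F_bounds)+
  have F_mono: "incseq (\<lambda>n. ennreal (F n x))" for x
    unfolding F_def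
    by (intro incseq_SucI ennreal_leI mult_mono prod_mono prod_nonneg)
       (auto simp: bump_bounds ramp_bounds intro: bump_mono ramp_mono)
  have F_lim: "(\<lambda>n. ennreal (F n x)) \<longlonglongrightarrow> indicator (Pi\<^sub>E UNIV U) x * indicator {y. N (y j) > \<delta>} x" for x
  proof -
    have "(\<lambda>n. F n x) \<longlonglongrightarrow> (\<Prod>i\<in>{s..t}. indicator (U i) (x i)) * indicator {1<..} (N (x j) / \<delta>)"
      unfolding F_def by (intro tendsto_mult tendsto_prod bump_LIMSEQ ramp_LIMSEQ U)
    also have "(\<Prod>i\<in>{s..t}. indicator (U i) (x i)) = (indicator (Pi\<^sub>E UNIV U) x :: real)"
    proof (cases "x \<in> Pi\<^sub>E UNIV U")
      case False
      then obtain i where "x i \<notin> U i" by auto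
      moreover from this have "i \<in> {s..t}" using off by fastforce
      ultimately have "(\<Prod>i\<in>{s..t}. indicator (U i) (x i)) = (0 :: real)"
        by (intro prod_zero bexI[of _ i]) auto
      then show ?thesis using False by simp
    qed (auto simp: PiE_iff)
    also have "(indicator {1<..} (N (x j) / \<delta>) :: real) = indicator {y. N (y j) > \<delta>} x"
      using \<delta> by (auto split: split_indicator simp: field_simps)
    finally have "(\<lambda>n. ennreal (F n x)) \<longlonglongrightarrow> ennreal (indicator (Pi\<^sub>E UNIV U) x * indicator {y. N (y j) > \<delta>} x)"
      by (rule tendsto_ennrealI)
    then show ?thesis by (simp add: ennreal_mult' ennreal_indicator)
  qed
  have "(\<lambda>n. \<integral>\<^sup>+y. ennreal (F n y) \<partial>\<nu>) \<longlonglongrightarrow>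
      (\<integral>\<^sup>+y. indicator (Pi\<^sub>E UNIV U) y * indicator {y. N (y j) > \<delta>} y \<partial>\<nu>)"
    using F_mono F_lim by (intro nn_integral_LIMSEQ) (auto simp: incseq_def le_fun_def)
  moreover have "(\<lambda>n. ennreal (\<delta> powr (- \<alpha>)) * (\<integral>\<^sup>+\<omega>. ennreal (F n (\<lambda>i. \<delta> *\<^sub>R Y (i - j) \<omega>)) \<partial>P)) \<longlonglongrightarrow>
      ennreal (\<delta> powr (- \<alpha>)) * (\<integral>\<^sup>+\<omega>. indicator (Pi\<^sub>E UNIV U) (\<lambda>i. \<delta> *\<^sub>R Y (i - j) \<omega>) *
        indicator {y. N (y j) > \<delta>} (\<lambda>i. \<delta> *\<^sub>R Y (i - j) \<omega>) \<partial>P)"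
    using F_mono F_lim
    by (intro ennreal_tendsto_cmult nn_integral_LIMSEQ measurable_compose[OF Y_seq_measurable])
       (auto simp: incseq_def le_fun_def)
  ultimately have "(\<integral>\<^sup>+y. indicator (Pi\<^sub>E UNIV U) y * indicator {y. N (y j) > \<delta>} y \<partial>\<nu>) =
      ennreal (\<delta> powr (- \<alpha>)) * (\<integral>\<^sup>+\<omega>. indicator (Pi\<^sub>E UNIV U) (\<lambda>i. \<delta> *\<^sub>R Y (i - j) \<omega>) *
        indicator {y. N (y j) > \<delta>} (\<lambda>i. \<delta> *\<^sub>R Y (i - j) \<omega>) \<partial>P)"
    unfolding test by (rule LIMSEQ_unique)
  also have "(\<integral>\<^sup>+\<omega>. indicator (Pi\<^sub>E UNIV U) (\<lambda>i. \<delta> *\<^sub>R Y (i - j) \<omega>) *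
        indicator {y. N (y j) > \<delta>} (\<lambda>i. \<delta> *\<^sub>R Y (i - j) \<omega>) \<partial>P) =
      (\<integral>\<^sup>+\<omega>. indicator (Pi\<^sub>E UNIV U) (\<lambda>i. \<delta> *\<^sub>R Y (i - j) \<omega>) \<partial>P)"
    using \<delta> by (intro nn_integral_cong_AE eventually_mono[OF norm_Y0_gt_1]) (simp add: N_scale)
  finally show ?thesis .
qed

text \<open>The description of \<open>\<nu>\<close> on which everything rests: on \<open>{N (y j) > \<delta>}\<close> it is \<open>\<delta> powr (- \<alpha>)\<close> times
  the law of \<open>\<delta>\<close> times the tail process shifted by \<open>j\<close>. Shift invariance and homogeneity of \<open>\<nu>\<close>
  are both contained in it, in the freedom to choose \<open>j\<close> and \<open>\<delta>\<close>.\<close>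
lemma tail_measure_exceedance:
  assumes \<delta>: "\<delta> > 0" and H [measurable]: "H \<in> borel_measurable borel"
  shows "(\<integral>\<^sup>+y. H y * indicator {y. N (y j) > \<delta>} y \<partial>\<nu>) =
    ennreal (\<delta> powr (- \<alpha>)) * (\<integral>\<^sup>+\<omega>. H (\<lambda>i. \<delta> *\<^sub>R Y (i - j) \<omega>) \<partial>P)"
proof -
  let ?Z = "\<lambda>\<omega> i. \<delta> *\<^sub>R Y (i - j) \<omega>"
  let ?E = "{Pi\<^sub>E UNIV U | U. (\<forall>i. open (U i)) \<and> finite {i. U i \<noteq> UNIV}} :: (int \<Rightarrow> real ^ 'd) set set"
  define V where "V = density \<nu> (indicator {y. N (y j) > \<delta>})"
  define W where "W = scale_measure (ennreal (\<delta> powr (- \<alpha>))) (distr P borel ?Z)"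
  have "V = W"
  proof (rule measure_eqI_generator_eq)
    show "Int_stable ?E"
    proof (rule Int_stableI, clarify)
      fix U U' :: "int \<Rightarrow> (real ^ 'd) set"
      assume a: "\<forall>i. open (U i)" "finite {i. U i \<noteq> UNIV}" "\<forall>i. open (U' i)" "finite {i. U' i \<noteq> UNIV}"
      then have "finite ({i. U i \<noteq> UNIV} \<union> {i. U' i \<noteq> UNIV})" by simp
      then have "finite {i. U i \<inter> U' i \<noteq> UNIV}" by (rule rev_finite_subset) auto
      then show "\<exists>V. Pi\<^sub>E UNIV U \<inter> Pi\<^sub>E UNIV U' = Pi\<^sub>E UNIV V \<and> (\<forall>i. open (V i)) \<and> finite {i. V i \<noteq> UNIV}"
        using a by (intro exI[of _ "\<lambda>i. U i \<inter> U' i"]) auto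
    qed
  next
    fix A assume "A \<in> ?E"
    then obtain U where U: "A = Pi\<^sub>E UNIV U" "\<And>i. open (U i)" "finite {i. U i \<noteq> UNIV}" by auto
    then have A [measurable]: "A \<in> sets borel" by (auto intro!: borel_open open_PiE)
    have "emeasure V A = (\<integral>\<^sup>+y. indicator A y * indicator {y. N (y j) > \<delta>} y \<partial>\<nu>)"
      unfolding V_def by (subst emeasure_density) (auto simp: mult.commute)
    also have "\<dots> = ennreal (\<delta> powr (- \<alpha>)) * (\<integral>\<^sup>+\<omega>. indicator A (?Z \<omega>) \<partial>P)"
      unfolding U(1) by (rule tail_measure_exceedance_box[OF \<delta> U(2,3)])
    also have "(\<integral>\<^sup>+\<omega>. indicator A (?Z \<omega>) \<partial>P) = emeasure (distr P borel ?Z) A"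
      by (simp add: nn_integral_distr flip: nn_integral_indicator)
    finally show "emeasure V A = emeasure W A" by (simp add: W_def)
  next
    have U: "UNIV \<in> ?E" by (rule CollectI, rule exI[of _ "\<lambda>_. UNIV"]) auto
    show "range (\<lambda>_::nat. UNIV) \<subseteq> ?E" using U by blast
    have "emeasure V UNIV = (\<integral>\<^sup>+y. indicator (Pi\<^sub>E UNIV (\<lambda>_. UNIV)) y * indicator {y. N (y j) > \<delta>} y \<partial>\<nu>)"
      unfolding V_def by (subst emeasure_density) (auto simp: \<nu>_sets)
    also have "\<dots> = ennreal (\<delta> powr (- \<alpha>)) * (\<integral>\<^sup>+\<omega>. indicator (Pi\<^sub>E UNIV (\<lambda>_. UNIV)) (?Z \<omega>) \<partial>P)"
      by (rule tail_measure_exceedance_box[OF \<delta>]) auto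
    also have "\<dots> < \<infinity>" by (simp add: P.emeasure_space_1)
    finally show "emeasure V UNIV \<noteq> \<infinity>" by simp
  qed (auto simp: V_def W_def \<nu>_sets sets_borel_open_boxes)
  have "(\<integral>\<^sup>+y. H y * indicator {y. N (y j) > \<delta>} y \<partial>\<nu>) = (\<integral>\<^sup>+y. H y \<partial>V)"
    unfolding V_def by (subst nn_integral_density) (auto simp: mult.commute)
  also have "\<dots> = ennreal (\<delta> powr (- \<alpha>)) * (\<integral>\<^sup>+\<omega>. H (?Z \<omega>) \<partial>P)"
    unfolding \<open>V = W\<close> W_def by (simp add: nn_integral_scale_measure nn_integral_distr)
  finally show ?thesis .
qed

end

section \<open>Sums over the integers\<close>

lemma infsum_int_eq_suminf:
  fixes f :: "int \<Rightarrow> ennreal"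
  shows "(\<Sum>\<^sub>\<infinity>j\<in>UNIV. f j) = (\<Sum>n. f (int_decode n))"
proof -
  have "(\<lambda>n. f (int_decode n)) summable_on UNIV"
    by (rule nonneg_summable_on_complete) simp
  then have "(\<lambda>n. f (int_decode n)) sums (\<Sum>\<^sub>\<infinity>n\<in>UNIV. f (int_decode n))"
    by (intro has_sum_imp_sums has_sum_infsum)
  then show ?thesis
    using infsum_reindex_bij_betw[OF bij_int_decode, of f] sums_unique by metis
qed

lemma infsum_int_eq_0_iff:
  fixes f :: "int \<Rightarrow> ennreal"
  shows "(\<Sum>\<^sub>\<infinity>j\<in>UNIV. f j) = 0 \<longleftrightarrow> (\<forall>j. f j = 0)"
proof -
  have "(\<Sum>\<^sub>\<infinity>j\<in>UNIV. f j) = 0 \<longleftrightarrow> (\<forall>n. f (int_decode n) = 0)"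
    unfolding infsum_int_eq_suminf by (rule suminf_eq_zero_iff) auto
  also have "\<dots> \<longleftrightarrow> (\<forall>j. f j = 0)"
    using surj_int_decode by (metis surj_def)
  finally show ?thesis .
qed

context tail_process_setting
begin

section \<open>The tail measure and the spectral tail process\<close>

abbreviation \<Theta> where "\<Theta> \<equiv> spectral_tail_process N Y"

lemma \<Theta>_measurable [measurable]: "\<Theta> \<in> borel_measurable P"
proof -
  have "(\<lambda>\<omega> j. (1 / N (Y 0 \<omega>)) *\<^sub>R Y j \<omega>) \<in> borel_measurable P"
    by (intro measurable_sequence borel_measurable_scaleR) measurable
  then show ?thesis by (simp add: spectral_tail_process_def[abs_def])
qed

lemma tail_measure_polar:
  assumes H: "H \<in> borel_measurable borel"
  shows "(\<integral>\<^sup>+y. H y * indicator {y. N (y j) > 0} y \<partial>\<nu>) =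
    (\<integral>\<^sup>+r\<in>{0<..}. (\<integral>\<^sup>+\<omega>. H (\<lambda>i. r *\<^sub>R backshift j (\<Theta> \<omega>) i) \<partial>P) *
       ennreal (\<alpha> * r powr (- \<alpha> - 1)) \<partial>lborel)"
proof -
  have Z: "(\<lambda>\<omega> i. Y (i - j) \<omega>) \<in> borel_measurable P" using Y_seq_measurable[of 1 j] by simp
  have "(\<integral>\<^sup>+y. H y * indicator {y. N (y j) > 0} y \<partial>\<nu>) =
    (\<integral>\<^sup>+r\<in>{0<..}. (\<integral>\<^sup>+\<omega>. H (\<lambda>i. r *\<^sub>R (1 / N (Y (j - j) \<omega>)) *\<^sub>R Y (i - j) \<omega>) \<partial>P) *
       ennreal (\<alpha> * r powr (- \<alpha> - 1)) \<partial>lborel)"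
    by (rule polar_decomposition[OF norm prob_P \<nu>_sets Z \<alpha>_pos]) (fact tail_measure_exceedance H)+
  then show ?thesis
    unfolding spectral_tail_process_def backshift_def by simp
qed

text \<open>Since the zero sequence has no mass, the sets \<open>{N (y j) > 1 / (n + 1)}\<close> exhaust \<open>\<nu>\<close>. This reduces
  statements about \<open>\<nu>\<close>-null sets to statements about the tail process.\<close>
lemma tail_measure_AE_nonzero: "AE y in \<nu>. \<exists>j. N (y j) > 0"
proof (rule AE_I')
  have "{\<lambda>_. 0} \<in> sets \<nu>" by (simp add: \<nu>_sets closed_singleton)
  then show "{\<lambda>_. 0} \<in> null_sets \<nu>"
    using tail_measure by (auto simp: is_tail_measure_def null_sets_def)
  show "{y \<in> space \<nu>. \<not> (\<exists>j. N (y j) > 0)} \<subseteq> {\<lambda>_. 0}"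
    using norm by (auto simp: is_norm_def order_less_le)
qed

lemma AE_tail_measureI:
  assumes S [measurable]: "{y. Q y} \<in> sets borel"
    and Q: "\<And>\<delta> j. \<delta> > 0 \<Longrightarrow> AE \<omega> in P. Q (\<lambda>i. \<delta> *\<^sub>R Y (i - j) \<omega>)"
  shows "AE y in \<nu>. Q y"
proof -
  have "AE y in \<nu>. N (y j) > 1 / real (Suc n) \<longrightarrow> Q y" for j n
  proof -
    have [measurable]: "{y. \<not> Q y} \<in> sets borel"
      using sets.compl_sets[OF S] by (simp add: Compl_eq_Diff_UNIV[symmetric] Collect_neg_eq)
    have "(\<integral>\<^sup>+y. indicator {y. \<not> Q y} y * indicator {y. N (y j) > 1 / real (Suc n)} y \<partial>\<nu>) =
        ennreal ((1 / real (Suc n)) powr (- \<alpha>)) *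
          (\<integral>\<^sup>+\<omega>. indicator {y. \<not> Q y} (\<lambda>i. (1 / real (Suc n)) *\<^sub>R Y (i - j) \<omega>) \<partial>P)"
      by (rule tail_measure_exceedance) auto
    also have "(\<integral>\<^sup>+\<omega>. indicator {y. \<not> Q y} (\<lambda>i. (1 / real (Suc n)) *\<^sub>R Y (i - j) \<omega>) \<partial>P) = (\<integral>\<^sup>+\<omega>. 0 \<partial>P)"
      by (intro nn_integral_cong_AE eventually_mono[OF Q[of "1 / real (Suc n)" j]]) auto
    finally have "AE y in \<nu>. indicator {y. \<not> Q y} y * indicator {y. N (y j) > 1 / real (Suc n)} y = (0 :: ennreal)"
      by (subst nn_integral_0_iff_AE[symmetric]) auto
    then show ?thesis by eventually_elim (auto split: split_indicator_asm)
  qed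
  then have "AE y in \<nu>. \<forall>j n. N (y j) > 1 / real (Suc n) \<longrightarrow> Q y"
    unfolding AE_all_countable by blast
  with tail_measure_AE_nonzero show ?thesis
  proof eventually_elim
    case (elim y)
    then obtain j where "N (y j) > 0" by auto
    then obtain n where "1 / real (Suc n) < N (y j)"
      using reals_Archimedean[of "N (y j)"] by (auto simp: inverse_eq_divide)
    then show ?case using elim(2) by blast
  qed
qed

lemma AE_tail_processI:
  assumes S [measurable]: "{y. Q y} \<in> sets borel" and Q: "AE y in \<nu>. Q y"
  shows "AE \<omega> in P. Q (\<lambda>i. Y i \<omega>)"
proof -
  have [measurable]: "{y. \<not> Q y} \<in> sets borel"
    using sets.compl_sets[OF S] by (simp add: Compl_eq_Diff_UNIV[symmetric] Collect_neg_eq)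
  have [measurable]: "(\<lambda>\<omega> i. Y i \<omega>) \<in> borel_measurable P" using Y_seq_measurable[of 1 0] by simp
  have "(\<integral>\<^sup>+\<omega>. indicator {y. \<not> Q y} (\<lambda>i. Y i \<omega>) \<partial>P) =
      (\<integral>\<^sup>+y. indicator {y. \<not> Q y} y * indicator {y. N (y 0) > 1} y \<partial>\<nu>)"
    using tail_measure_exceedance[of 1 "indicator {y. \<not> Q y}" 0] by simp
  also have "\<dots> = (\<integral>\<^sup>+y. 0 \<partial>\<nu>)"
    using Q by (intro nn_integral_cong_AE) (auto elim!: eventually_mono)
  finally have "AE \<omega> in P. indicator {y. \<not> Q y} (\<lambda>i. Y i \<omega>) = (0 :: ennreal)"
    by (subst nn_integral_0_iff_AE[symmetric]) auto
  then show ?thesis by eventually_elim (auto split: split_indicator_asm)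
qed

text \<open>The equivalence holds for all coordinates together: coordinate \<open>k\<close> of \<open>B^j Y\<close> is coordinate
  \<open>k - j\<close> of \<open>Y\<close>, so one coordinate of \<open>\<nu>\<close> is controlled by all coordinates of \<open>Y\<close>.\<close>
lemma tail_measure_zero_iff:
  "(\<forall>j. emeasure \<nu> {y. N (y j) = 0} = 0) \<longleftrightarrow>
   (\<forall>j. emeasure P {\<omega> \<in> space P. N (\<Theta> \<omega> j) = 0} = 0)"
proof -
  have meas: "{y :: int \<Rightarrow> real ^ 'd. N (y j) \<noteq> 0} \<in> sets borel" for j by measurable
  have \<nu>: "emeasure \<nu> {y. N (y j) = 0} = 0 \<longleftrightarrow> (AE y in \<nu>. N (y j) \<noteq> 0)" for j
    by (subst AE_iff_measurable[OF _ refl]) (auto simp: \<nu>_space)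
  have \<Theta>: "emeasure P {\<omega> \<in> space P. N (\<Theta> \<omega> j) = 0} = 0 \<longleftrightarrow> (AE \<omega> in P. N (\<Theta> \<omega> j) \<noteq> 0)" for j
    by (subst AE_iff_measurable[OF _ refl]) auto
  have Y: "(AE \<omega> in P. N (\<Theta> \<omega> j) \<noteq> 0) \<longleftrightarrow> (AE \<omega> in P. N (Y j \<omega>) \<noteq> 0)" for j
  proof -
    have "AE \<omega> in P. N (\<Theta> \<omega> j) \<noteq> 0 \<longleftrightarrow> N (Y j \<omega>) \<noteq> 0"
      using norm_Y0_gt_1 by eventually_elim (simp add: spectral_tail_process_def N_scale)
    then show ?thesis by (rule eventually_subst)
  qed
  show ?thesis unfolding \<nu> \<Theta> Y
  proof safe
    fix j assume "\<forall>j. AE y in \<nu>. N (y j) \<noteq> 0"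
    then show "AE \<omega> in P. N (Y j \<omega>) \<noteq> 0" by (intro AE_tail_processI[OF meas]) simp
  next
    fix k assume a: "\<forall>j. AE \<omega> in P. N (Y j \<omega>) \<noteq> 0"
    show "AE y in \<nu>. N (y k) \<noteq> 0"
    proof (rule AE_tail_measureI[OF meas])
      fix \<delta> :: real and j :: int assume "\<delta> > 0"
      with a[rule_format, of "k - j"] show "AE \<omega> in P. N (\<delta> *\<^sub>R Y (k - j) \<omega>) \<noteq> 0"
        by (auto simp: N_scale)
    qed
  qed
qed

text \<open>By scale invariance and shift equivariance, the infargmax is almost surely finite for every positive
  multiple of every shift of \<open>Y\<close> as soon as it is so for \<open>\<Theta>\<close>.\<close>
lemma AE_infargmax_finite:
  assumes "\<P>(\<omega> in P. infargmax N (\<Theta> \<omega>) \<in> range Fin) = 1"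
  shows "AE y in \<nu>. \<exists>k. infargmax N y = Fin k"
proof (rule AE_tail_measureI)
  note [measurable] = measurable_infargmax_eq[OF N_measurable]
  have "{y. \<exists>k. infargmax N y = Fin k} = (\<Union>k. {y. infargmax N y = Fin k})" by auto
  also have "\<dots> \<in> sets borel" by measurable
  finally show meas [measurable]: "{y. \<exists>k. infargmax N y = Fin k} \<in> sets borel" .
  fix \<delta> :: real and j :: int assume \<delta>: "\<delta> > 0"
  have "{\<omega> \<in> space P. \<exists>k. infargmax N (\<Theta> \<omega>) = Fin k} \<in> sets P"
    using measurable_sets[OF \<Theta>_measurable meas] by (simp add: vimage_def Int_def conj_commute)
  moreover have "\<P>(\<omega> in P. \<exists>k. infargmax N (\<Theta> \<omega>) = Fin k) = 1"
    using assms by (simp add: image_iff)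
  ultimately have "AE \<omega> in P. \<exists>k. infargmax N (\<Theta> \<omega>) = Fin k"
    by (subst (asm) P.prob_Collect_eq_1)
  with norm_Y0_gt_1 show "AE \<omega> in P. \<exists>k. infargmax N (\<lambda>i. \<delta> *\<^sub>R Y (i - j) \<omega>) = Fin k"
  proof eventually_elim
    case (elim \<omega>)
    then obtain k where "infargmax N (\<Theta> \<omega>) = Fin k" by auto
    then have "infargmax N (\<lambda>i. Y i \<omega>) = Fin k"
      using elim infargmax_scale[OF norm, of "1 / N (Y 0 \<omega>)" "\<lambda>i. Y i \<omega>"] by (simp add: spectral_tail_process_def)
    then have "infargmax N (backshift j (\<lambda>i. Y i \<omega>)) = Fin (k + j)"
      by (simp add: infargmax_backshift)
    then show ?case
      using infargmax_scale[OF norm \<delta>, of "backshift j (\<lambda>i. Y i \<omega>)"] by (auto simp: backshift_def)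
  qed
qed

text \<open>Split \<open>\<nu>\<close> according to the value \<open>j\<close> of the infargmax. Where it equals \<open>j\<close>, the coordinate \<open>j\<close>
  exceeds all earlier ones strictly and so is non-zero, and the polar decomposition at \<open>j\<close> applies. The
  event that \<open>r B^j \<Theta>\<close> has infargmax \<open>j\<close> is the event that \<open>\<Theta>\<close> has infargmax 0.\<close>
lemma tail_measure_representation:
  assumes fin: "\<P>(\<omega> in P. infargmax N (\<Theta> \<omega>) \<in> range Fin) = 1"
    and H [measurable]: "H \<in> borel_measurable borel"
  shows "(\<integral>\<^sup>+y. H y \<partial>\<nu>) =
     (\<Sum>\<^sub>\<infinity>j\<in>UNIV. \<integral>\<^sup>+r\<in>{0<..}.
        (\<integral>\<^sup>+\<omega>. H (\<lambda>i. r *\<^sub>R backshift j (\<Theta> \<omega>) i) *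
             indicator {\<omega>. infargmax N (\<Theta> \<omega>) = Fin 0} \<omega> \<partial>P) *
        ennreal (\<alpha> * r powr (- \<alpha> - 1)) \<partial>lborel)"
proof -
  note [measurable] = measurable_infargmax_eq[OF N_measurable]
  define I where "I j = {y. infargmax N y = Fin j}" for j
  have [measurable]: "I j \<in> sets borel" for j unfolding I_def by measurable
  have "(\<integral>\<^sup>+y. H y \<partial>\<nu>) = (\<integral>\<^sup>+y. (\<Sum>n. H y * indicator (I (int_decode n)) y) \<partial>\<nu>)"
  proof (intro nn_integral_cong_AE eventually_mono[OF AE_infargmax_finite[OF fin]])
    fix y assume "\<exists>k. infargmax N y = Fin k"
    then obtain k where k: "infargmax N y = Fin k" by auto
    have off: "int_decode n \<noteq> k" if "n \<noteq> int_encode k" for n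
      using that by (metis int_decode_inverse)
    have "(\<Sum>n. H y * indicator (I (int_decode n)) y) = (\<Sum>n\<in>{int_encode k}. H y * indicator (I (int_decode n)) y)"
    proof (rule suminf_finite)
      fix n assume "n \<notin> {int_encode k}"
      then show "H y * indicator (I (int_decode n)) y = 0" using k off[of n] by (auto simp: I_def)
    qed simp
    also have "\<dots> = H y" using k by (simp add: I_def)
    finally show "H y = (\<Sum>n. H y * indicator (I (int_decode n)) y)" by (rule sym)
  qed
  also have "\<dots> = (\<Sum>n. \<integral>\<^sup>+y. H y * indicator (I (int_decode n)) y \<partial>\<nu>)"
    by (rule nn_integral_suminf) measurable
  also have "\<dots> = (\<Sum>\<^sub>\<infinity>j\<in>UNIV. \<integral>\<^sup>+y. H y * indicator (I j) y \<partial>\<nu>)"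
    by (simp add: infsum_int_eq_suminf)
  also have "\<dots> = (\<Sum>\<^sub>\<infinity>j\<in>UNIV. \<integral>\<^sup>+r\<in>{0<..}.
        (\<integral>\<^sup>+\<omega>. H (\<lambda>i. r *\<^sub>R backshift j (\<Theta> \<omega>) i) *
             indicator {\<omega>. infargmax N (\<Theta> \<omega>) = Fin 0} \<omega> \<partial>P) *
        ennreal (\<alpha> * r powr (- \<alpha> - 1)) \<partial>lborel)"
  proof (intro infsum_cong)
    fix j :: int
    have pos: "N (y j) > 0" if "y \<in> I j" for y
    proof -
      have "max_norm N {..j - 1} y < ennreal (N (y j))"
        using that by (simp add: I_def infargmax_eq_Fin_iff is_infargmax_def)
      then have "0 < ennreal (N (y j))" by (rule le_less_trans[OF zero_le])
      then show ?thesis by simp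
    qed
    have "(\<integral>\<^sup>+y. H y * indicator (I j) y \<partial>\<nu>) =
        (\<integral>\<^sup>+y. H y * indicator (I j) y * indicator {y. N (y j) > 0} y \<partial>\<nu>)"
      by (intro nn_integral_cong) (auto split: split_indicator dest: pos)
    also have "\<dots> = (\<integral>\<^sup>+r\<in>{0<..}. (\<integral>\<^sup>+\<omega>. H (\<lambda>i. r *\<^sub>R backshift j (\<Theta> \<omega>) i) *
        indicator (I j) (\<lambda>i. r *\<^sub>R backshift j (\<Theta> \<omega>) i) \<partial>P) * ennreal (\<alpha> * r powr (- \<alpha> - 1)) \<partial>lborel)"
      by (rule tail_measure_polar) measurable
    also have "\<dots> = (\<integral>\<^sup>+r\<in>{0<..}.
        (\<integral>\<^sup>+\<omega>. H (\<lambda>i. r *\<^sub>R backshift j (\<Theta> \<omega>) i) *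
             indicator {\<omega>. infargmax N (\<Theta> \<omega>) = Fin 0} \<omega> \<partial>P) *
        ennreal (\<alpha> * r powr (- \<alpha> - 1)) \<partial>lborel)"
    proof (intro nn_integral_cong)
      fix r :: real
      have "(indicator (I j) (\<lambda>i. r *\<^sub>R backshift j (\<Theta> \<omega>) i) :: ennreal) =
          indicator {\<omega>. infargmax N (\<Theta> \<omega>) = Fin 0} \<omega>" if "r > 0" for \<omega>
        using that by (simp add: I_def indicator_def infargmax_scale[OF norm] infargmax_backshift)
      then show "(\<integral>\<^sup>+\<omega>. H (\<lambda>i. r *\<^sub>R backshift j (\<Theta> \<omega>) i) *
          indicator (I j) (\<lambda>i. r *\<^sub>R backshift j (\<Theta> \<omega>) i) \<partial>P) * ennreal (\<alpha> * r powr (- \<alpha> - 1)) * indicator {0<..} r =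
        (\<integral>\<^sup>+\<omega>. H (\<lambda>i. r *\<^sub>R backshift j (\<Theta> \<omega>) i) *
          indicator {\<omega>. infargmax N (\<Theta> \<omega>) = Fin 0} \<omega> \<partial>P) * ennreal (\<alpha> * r powr (- \<alpha> - 1)) * indicator {0<..} r"
        by (auto split: split_indicator)
    qed
    finally show "(\<integral>\<^sup>+y. H y * indicator (I j) y \<partial>\<nu>) = \<dots>" .
  qed
  finally show ?thesis .
qed

text \<open>Otherwise the representation would make \<open>\<nu>\<close> the zero measure, but \<open>{N (y 0) > 1}\<close> has mass 1.\<close>
lemma prob_infargmax_0_pos:
  assumes fin: "\<P>(\<omega> in P. infargmax N (\<Theta> \<omega>) \<in> range Fin) = 1"
  shows "\<P>(\<omega> in P. infargmax N (\<Theta> \<omega>) = Fin 0) > 0"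
proof (rule ccontr)
  assume "\<not> ?thesis"
  then have "\<P>(\<omega> in P. infargmax N (\<Theta> \<omega>) = Fin 0) = 0"
    by (simp add: zero_less_measure_iff)
  moreover have "{\<omega> \<in> space P. infargmax N (\<Theta> \<omega>) = Fin 0} \<in> sets P"
    using measurable_sets[OF \<Theta>_measurable measurable_infargmax_eq[OF N_measurable, of 0]]
    by (simp add: vimage_def Int_def conj_commute)
  ultimately have "AE \<omega> in P. infargmax N (\<Theta> \<omega>) \<noteq> Fin 0"
    by (subst (asm) P.prob_Collect_eq_0)
  then have "(\<integral>\<^sup>+\<omega>. indicator {\<omega>. infargmax N (\<Theta> \<omega>) = Fin 0} \<omega> \<partial>P) = (\<integral>\<^sup>+\<omega>. 0 \<partial>P)"
    by (intro nn_integral_cong_AE) (auto elim!: eventually_mono)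
  then have "(\<integral>\<^sup>+y. 1 \<partial>\<nu>) = 0"
    using tail_measure_representation[OF fin, of "\<lambda>_. 1"] by simp
  moreover have "(\<integral>\<^sup>+y. indicator {y. N (y 0) > 1} y \<partial>\<nu>) = 1"
    using tail_measure_exceedance[of 1 "\<lambda>_. 1" 0] by (simp add: P.emeasure_space_1)
  moreover have "(\<integral>\<^sup>+y. indicator {y. N (y 0) > 1} y \<partial>\<nu>) \<le> (\<integral>\<^sup>+y. 1 \<partial>\<nu>)"
    by (intro nn_integral_mono) (simp add: indicator_le_1 split: split_indicator)
  ultimately show False by simp
qed

lemma tail_measure_polar_representation:
  assumes zero: "emeasure \<nu> {y. N (y 0) = 0} = 0"
    and H: "H \<in> borel_measurable borel"
  shows "(\<integral>\<^sup>+y. H y \<partial>\<nu>) =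
    (\<integral>\<^sup>+r\<in>{0<..}. (\<integral>\<^sup>+\<omega>. H (\<lambda>i. r *\<^sub>R \<Theta> \<omega> i) \<partial>P) * ennreal (\<alpha> * r powr (- \<alpha> - 1)) \<partial>lborel)"
proof -
  have "AE y in \<nu>. N (y 0) \<noteq> 0"
    using zero by (subst AE_iff_measurable[OF _ refl]) (auto simp: \<nu>_space)
  then have "AE y in \<nu>. H y = H y * indicator {y. N (y 0) > 0} y"
    by eventually_elim (use N_nonneg in \<open>auto simp: less_le\<close>)
  then have "(\<integral>\<^sup>+y. H y \<partial>\<nu>) = (\<integral>\<^sup>+y. H y * indicator {y. N (y 0) > 0} y \<partial>\<nu>)"
    by (rule nn_integral_cong_AE)
  then show ?thesis using tail_measure_polar[OF H, of 0] by (simp add: backshift_0)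
qed

end

section \<open>Representation of the tail measure\<close>

theorem theorem3p1:
  fixes N :: "real ^ 'd \<Rightarrow> real"
    and M :: "'w measure" and X :: "int \<Rightarrow> 'w \<Rightarrow> real ^ 'd"
    and \<nu>w :: "int \<Rightarrow> int \<Rightarrow> (int \<Rightarrow> real ^ 'd) measure"
    and \<alpha> :: real
    and P :: "'v measure" and Y :: "int \<Rightarrow> 'v \<Rightarrow> real ^ 'd"
    and \<nu> :: "(int \<Rightarrow> real ^ 'd) measure"
  assumes "is_norm N"
    and "prob_space M" and "\<And>j. X j \<in> borel_measurable M"
    and "stationary M X"
    and "regularly_varying N M X \<nu>w"
    and "has_tail_index N M X \<alpha>"
    and "prob_space P" and "\<And>j. Y j \<in> borel_measurable P"
    and "is_tail_process N M X \<alpha> P Y"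
    and "is_tail_measure \<nu>w \<nu>"
    and "\<P>(\<omega> in P. infargmax N (spectral_tail_process N Y \<omega>) \<in> range Fin) = 1"
  shows "\<P>(\<omega> in P. infargmax N (spectral_tail_process N Y \<omega>) = Fin 0) > 0 \<and>
         (\<forall>H :: (int \<Rightarrow> real ^ 'd) \<Rightarrow> ennreal. H \<in> borel_measurable borel \<longrightarrow>
           (\<integral>\<^sup>+y. H y \<partial>\<nu>) =
           (\<Sum>\<^sub>\<infinity>j\<in>(UNIV :: int set).
              \<integral>\<^sup>+r\<in>{0<..}.
                (\<integral>\<^sup>+\<omega>. H (\<lambda>i. r *\<^sub>R backshift j (spectral_tail_process N Y \<omega>) i) *
                     indicator {\<omega>. infargmax N (spectral_tail_process N Y \<omega>) = Fin 0} \<omega> \<partial>P) *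
                ennreal (\<alpha> * r powr (- \<alpha> - 1)) \<partial>lborel)) \<and>
         ((\<Sum>\<^sub>\<infinity>j\<in>(UNIV :: int set). emeasure \<nu> {y. N (y j) = 0}) = 0 \<longleftrightarrow>
         (\<Sum>\<^sub>\<infinity>j\<in>(UNIV :: int set).
            emeasure P {\<omega> \<in> space P. N (spectral_tail_process N Y \<omega> j) = 0}) = 0) \<and>
         ((\<Sum>\<^sub>\<infinity>j\<in>(UNIV :: int set). emeasure \<nu> {y. N (y j) = 0}) = 0 \<longrightarrow>
         (\<forall>H :: (int \<Rightarrow> real ^ 'd) \<Rightarrow> ennreal. H \<in> borel_measurable borel \<longrightarrow>
            (\<integral>\<^sup>+y. H y \<partial>\<nu>) =
            (\<integral>\<^sup>+r\<in>{0<..}.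
               (\<integral>\<^sup>+\<omega>. H (\<lambda>i. r *\<^sub>R spectral_tail_process N Y \<omega> i) \<partial>P) *
               ennreal (\<alpha> * r powr (- \<alpha> - 1)) \<partial>lborel)))"
proof -
  interpret tail_process_setting N M X \<nu>w \<alpha> P Y \<nu>
    by (rule tail_process_setting.intro) (fact assms)+
  have zero: "(\<Sum>\<^sub>\<infinity>j\<in>UNIV. emeasure \<nu> {y. N (y j) = 0}) = 0 \<longleftrightarrow>
      (\<Sum>\<^sub>\<infinity>j\<in>UNIV. emeasure P {\<omega> \<in> space P. N (\<Theta> \<omega> j) = 0}) = 0"
    unfolding infsum_int_eq_0_iff by (rule tail_measure_zero_iff)
  have polar: "(\<integral>\<^sup>+y. H y \<partial>\<nu>) =
      (\<integral>\<^sup>+r\<in>{0<..}. (\<integral>\<^sup>+\<omega>. H (\<lambda>i. r *\<^sub>R \<Theta> \<omega> i) \<partial>P) * ennreal (\<alpha> * r powr (- \<alpha> - 1)) \<partial>lborel)"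
    if "(\<Sum>\<^sub>\<infinity>j\<in>UNIV. emeasure \<nu> {y. N (y j) = 0}) = 0" "H \<in> borel_measurable borel" for H
    using that(1) unfolding infsum_int_eq_0_iff by (intro tail_measure_polar_representation that(2)) blast
  show ?thesis
    by (intro conjI allI impI prob_infargmax_0_pos tail_measure_representation zero polar assms(11))
qed

end
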